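(* Let $X$ be a random vector in $\mathbb{R}_+^n$, let $\Phi\in\mathbb{R}_+^{m\times n}$, $\lambda\in\mathbb{R}_+^m$, and let $Y\in\mathbb{Z}_+^m$ be the output of the vector Poisson channel $$P(Y|X)=\prod_{i=1}^mP(Y_i|X)=\prod_{i=1}^m\mathrm{Pois}\big((\Phi X)_i+\lambda_i\big).$$ Assume that the regularity conditions permitting free interchange of differentiation and expectation hold. Then the gradient of mutual information with respect to the scaling matrix can be represented as $$\nabla_\Phi I(X;Y)=\mathbb{E}\big[D_F(X,\mathbb{E}[X|Y])\big],$$ where $D_F(\cdot,\cdot)$ is the generalized Bregman divergence associated with the $m\times n$ matrix-valued function $$F(x)=\Big(x\,(\log(\Phi x+\lambda))^T-[x,\dots,x]+[\mathbf{1},\dots,\mathbf{1}]\Big)^T,$$ i.e. $F(x)_{ij}=x_j\log((\Phi x)_i+\lambda_i)-x_j+1$ for $1\le i\le m$, $1\le j\le n$.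
   Context: $\mathrm{Pois}(z)$ is the Poisson distribution with parameter $z$; given $X$, the components of $Y$ are conditionally independent. Logarithms are natural, and the logarithm of a vector is taken entrywise. $[x,\dots,x]$ is the $n\times m$ matrix with $m$ columns equal to $x$, and $\mathbf{1}=[1,\dots,1]^T$, so $[\mathbf{1},\dots,\mathbf{1}]$ is the all-ones $n\times m$ matrix. $I(X;Y)$ is the mutual information, and $\nabla_\Phi I(X;Y)$ is the $m\times n$ matrix with $(i,j)$ entry $\partial I(X;Y)/\partial\Phi_{ij}$. The generalized Bregman divergence associated with a Fréchet-differentiable function $F:\Omega\to\mathbb{R}^{m\times n}$ on a convex set $\Omega$ is $$D_F(x,y):=F(x)-F(y)-DF(y)(x-y)\in\mathbb{R}^{m\times n},$$ where $DF(y)(\cdot)$ is the Fréchet derivative of $F$ at $y$. (In the general definition $F$ is strictly $K$-convex for a proper cone $K\subset\mathbb{R}^{m\times n}$; no cone $K$ is specified in this theorem, and the formula for $D_F$ does not involve $K$.) Standing assumption: the regularity conditions needed to interchange freely the order of $\partial/\partial\Phi_{ij}$ and $\mathbb{E}(\cdot)$ hold. *)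

theory Defs
  imports "HOL-Probability.Probability"
begin

definition gen_bregman ::
    "('a::real_normed_vector \<Rightarrow> 'b::real_normed_vector) \<Rightarrow> 'a \<Rightarrow> 'a \<Rightarrow> 'b" where
  "gen_bregman F x y = F x - F y - frechet_derivative F (at y) (x - y)"

text \<open>
  The probability mass function of Pois(z), for all z >= 0.  The library's \<^term>\<open>poisson_pmf\<close> is only
  specified for z > 0; since \<^prop>\<open>(0::real) ^ 0 = 1\<close>, the formula below gives the unit mass
  at 0 for z = 0.
\<close>

definition poisson_mass :: "real \<Rightarrow> nat \<Rightarrow> real" where
  "poisson_mass z k = z ^ k / fact k * exp (- z)"

definition poisson_channel_mass ::
    "real^'n^'m \<Rightarrow> real^'m \<Rightarrow> real^'n \<Rightarrow> nat^'m \<Rightarrow> real" where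
  "poisson_channel_mass \<Phi> lam x y = (\<Prod>i\<in>UNIV. poisson_mass ((\<Phi> *v x) $ i + lam $ i) (y $ i))"

definition generated_by :: "'a measure \<Rightarrow> ('a \<Rightarrow> 'b) \<Rightarrow> 'b measure \<Rightarrow> 'a measure" where
  "generated_by M Z N = vimage_algebra (space M) Z N"

text \<open>
  Y is an output of the channel with input X: the conditional probability of the event Y = y
  given X is the product of the Poisson masses.
\<close>

definition poisson_channel_output ::
    "'a measure \<Rightarrow> real^'n^'m \<Rightarrow> real^'m \<Rightarrow> ('a \<Rightarrow> real^'n) \<Rightarrow> ('a \<Rightarrow> nat^'m) \<Rightarrow> bool" where
  "poisson_channel_output M \<Phi> lam X Y \<longleftrightarrow>
     Y \<in> measurable M (count_space UNIV) \<and>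
     (\<forall>y. AE \<omega> in M.
        real_cond_exp M (generated_by M X borel) (\<lambda>\<omega>'. indicator {y} (Y \<omega>')) \<omega>
          = poisson_channel_mass \<Phi> lam (X \<omega>) y)"

definition cond_mean ::
    "'a measure \<Rightarrow> ('a \<Rightarrow> real^'n) \<Rightarrow> ('a \<Rightarrow> nat^'m) \<Rightarrow> 'a \<Rightarrow> real^'n" where
  "cond_mean M X Y \<omega> =
     (\<chi> j. real_cond_exp M (generated_by M Y (count_space UNIV)) (\<lambda>\<omega>'. X \<omega>' $ j) \<omega>)"

definition mutual_info ::
    "'a measure \<Rightarrow> ('a \<Rightarrow> real^'n) \<Rightarrow> ('a \<Rightarrow> nat^'m) \<Rightarrow> real" where
  "mutual_info M X Y = prob_space.mutual_information M (exp 1) borel (count_space UNIV) X Y"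

definition upd_entry :: "real^'n^'m \<Rightarrow> 'm \<Rightarrow> 'n \<Rightarrow> real \<Rightarrow> real^'n^'m" where
  "upd_entry \<Phi> i j s = (\<chi> k l. if k = i \<and> l = j then s else \<Phi> $ k $ l)"

text \<open>
  Scaling matrices have nonnegative entries, so derivatives are taken within \<^term>\<open>{0::real..}\<close>:
  this is the ordinary derivative at a positive entry and the right derivative at a zero entry.
\<close>

definition has_matrix_gradient ::
    "(real^'n^'m \<Rightarrow> real) \<Rightarrow> real^'n^'m \<Rightarrow> real^'n^'m \<Rightarrow> bool" where
  "has_matrix_gradient f G \<Phi> \<longleftrightarrow>
     (\<forall>i j. ((\<lambda>s. f (upd_entry \<Phi> i j s)) has_real_derivative G $ i $ j)
              (at (\<Phi> $ i $ j) within {0..}))"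

definition deriv_integral_interchange ::
    "'b measure \<Rightarrow> (real \<Rightarrow> 'b \<Rightarrow> real) \<Rightarrow> real \<Rightarrow> bool" where
  "deriv_integral_interchange N g t \<longleftrightarrow>
     integrable N (g t) \<and>
     (\<forall>\<^sub>F s in at t within {0..}. integrable N (g s)) \<and>
     (\<exists>g'. (AE z in N. ((\<lambda>s. g s z) has_real_derivative g' z) (at t within {0..})) \<and>
           integrable N g' \<and>
           ((\<lambda>s. \<integral>z. g s z \<partial>N) has_real_derivative (\<integral>z. g' z \<partial>N)) (at t within {0..}))"

definition output_mass ::
    "'a measure \<Rightarrow> ('a \<Rightarrow> real^'n) \<Rightarrow> real^'n^'m \<Rightarrow> real^'m \<Rightarrow> nat^'m \<Rightarrow> real" where
  "output_mass M X \<Phi> lam y = (\<integral>\<omega>. poisson_channel_mass \<Phi> lam (X \<omega>) y \<partial>M)"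

text \<open>
  The two expectations that are differentiated are P(Y = y) = E[P(y|X)] and
  I(X;Y) = E[log (P(Y|X) / P(Y))].  The joint law of (X, Y) depends on the scaling matrix, so
  the second expectation is written as an integral with respect to the fixed measure
  M \<Otimes> counting measure, with P(y|X) as density.
\<close>

definition interchange_regular ::
    "'a measure \<Rightarrow> ('a \<Rightarrow> real^'n) \<Rightarrow> real^'n^'m \<Rightarrow> real^'m \<Rightarrow> bool" where
  "interchange_regular M X \<Phi> lam \<longleftrightarrow>
     (\<forall>i j.
        (\<forall>y. deriv_integral_interchange M
               (\<lambda>s \<omega>. poisson_channel_mass (upd_entry \<Phi> i j s) lam (X \<omega>) y) (\<Phi> $ i $ j)) \<and>
        deriv_integral_interchange (M \<Otimes>\<^sub>M count_space UNIV)
          (\<lambda>s (\<omega>, y).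
             poisson_channel_mass (upd_entry \<Phi> i j s) lam (X \<omega>) y *
             ln (poisson_channel_mass (upd_entry \<Phi> i j s) lam (X \<omega>) y /
                 output_mass M X (upd_entry \<Phi> i j s) lam y))
          (\<Phi> $ i $ j))"

definition poisson_bregman_fun ::
    "real^'n^'m \<Rightarrow> real^'m \<Rightarrow> real^'n \<Rightarrow> real^'n^'m" where
  "poisson_bregman_fun \<Phi> lam x =
     (\<chi> i j. x $ j * ln ((\<Phi> *v x) $ i + lam $ i) - x $ j + 1)"

text \<open>
  The open convex set on which all logarithms in the function above are defined; there the
  function is Frechet differentiable.  (In HOL, \<^prop>\<open>ln (0::real) = 0\<close>, so the
  function itself is total and obeys the convention 0 log 0 = 0.)
\<close>

definition poisson_bregman_dom :: "real^'n^'m \<Rightarrow> real^'m \<Rightarrow> (real^'n) set" where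
  "poisson_bregman_dom \<Phi> lam = {x. \<forall>i. 0 < (\<Phi> *v x) $ i + lam $ i}"

end

(*
  Write p(x, y) for the channel mass, q(y) for the law of the output and L = ln (p / q), so that
  I(X;Y) is the integral of p L over M (x) counting measure for every nonnegative scaling matrix.
  In the entry (i, j) the mass has derivative p' = x_j (p(x, y - e_i) - p(x, y)), and the terms of
  (p L)' other than p' L integrate to 0. Summation by parts turns the integral of p' L into
  E[X_j (L(X, Y + e_i) - L(X, Y))], and since (y_i + 1) p(x, y + e_i) = z_i(x) p(x, y) for the rate
  z(x) = \<Phi> x + \<lambda>, the difference of L is ln z_i(x) - ln z_i(E[X|Y = y]). The Bregman divergence
  differs from x_j (ln z_i(x) - ln z_i(a)) by a term of conditional mean 0 at a = E[X|Y].
*)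

theory Submission
  imports Defs
begin

subsection \<open>Poisson masses and shifts of the output\<close>

text \<open>The main obstacle is integrability: p L is integrable over inputs and outputs together,
  but x_j p L is not assumed to be. So p' L is never split under the double integral. Its
  integrability is extracted from the interchange hypothesis by removing p' and (q'/q) p. These two
  integrate to 0, because a shift of y preserves sums and because averaging (q'/q) p over the input
  leaves q'. The split of p' L is made for one input at a time, where x_j is a constant. In the
  other direction, integrability of the divergence yields that of the difference of logarithms. The
  second obstacle is vanishing rates: where p = 0, the product rule for p L is useful only if p' = 0
  as well, and the assumed differentiability of p L forces this almost surely. The posterior mean
  enters because z is affine: averaging the recursion for p over the input gives the same recursion
  for q, with z(E[X|Y = y]) as its rate.\<close>

definition inc_entry :: "'m \<Rightarrow> nat^'m \<Rightarrow> nat^'m" where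
  "inc_entry i y = (\<chi> k. if k = i then Suc (y $ k) else y $ k)"

text \<open>Subtraction on nat truncates, so an output with \<open>y $ i = 0\<close> is fixed
  instead of shifted. This is the reason for the guards \<open>y $ i = 0\<close> below.\<close>

definition dec_entry :: "'m \<Rightarrow> nat^'m \<Rightarrow> nat^'m" where
  "dec_entry i y = (\<chi> k. if k = i then y $ k - 1 else y $ k)"

lemma dec_inc_entry [simp]: "dec_entry i (inc_entry i y) = y"
  by (simp add: dec_entry_def inc_entry_def vec_eq_iff)

lemma inc_dec_entry: "y $ i \<noteq> 0 \<Longrightarrow> inc_entry i (dec_entry i y) = y"
  by (simp add: dec_entry_def inc_entry_def vec_eq_iff)

lemma inc_entry_nth [simp]: "inc_entry i y $ i = Suc (y $ i)"
  by (simp add: inc_entry_def)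

lemma bij_betw_inc_entry: "bij_betw (inc_entry i) UNIV {y. y $ i \<noteq> 0}"
  by (rule bij_betw_byWitness[where f' = "dec_entry i"]) (auto simp: inc_dec_entry)

text \<open>Reindexing along the bijection from all outputs onto those with positive i-th entry; the
  guard extends by 0 to the outputs that are not reached.\<close>

lemma
  fixes f :: "nat^'m \<Rightarrow> real"
  shows integrable_inc_entry:
      "integrable (count_space UNIV) (\<lambda>y. if y $ i = 0 then 0 else f y) \<longleftrightarrow>
       integrable (count_space UNIV) (\<lambda>y. f (inc_entry i y))"
    and integral_inc_entry:
      "(\<integral>y. (if y $ i = 0 then 0 else f y) \<partial>count_space UNIV) =
       (\<integral>y. f (inc_entry i y) \<partial>count_space UNIV)"
proof -
  have eq: "(\<lambda>y. if y $ i = 0 then 0 else f y) = (\<lambda>y. indicator {y. y $ i \<noteq> 0} y *\<^sub>R f y)"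
    by (auto simp: fun_eq_iff)
  have r: "restrict_space (count_space UNIV) {y :: nat^'m. y $ i \<noteq> 0} = count_space {y. y $ i \<noteq> 0}"
    by (simp add: restrict_count_space)
  show "integrable (count_space UNIV) (\<lambda>y. if y $ i = 0 then 0 else f y) \<longleftrightarrow>
       integrable (count_space UNIV) (\<lambda>y. f (inc_entry i y))"
    unfolding eq integrable_bij_count_space[OF bij_betw_inc_entry]
    by (subst integrable_restrict_space[symmetric]) (simp_all only: r, simp_all)
  show "(\<integral>y. (if y $ i = 0 then 0 else f y) \<partial>count_space UNIV) =
       (\<integral>y. f (inc_entry i y) \<partial>count_space UNIV)"
    unfolding eq integral_bij_count_space[OF bij_betw_inc_entry]
    by (subst integral_restrict_space[symmetric]) (simp_all only: r, simp_all)
qed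

lemma poisson_mass_nonneg: "0 \<le> z \<Longrightarrow> 0 \<le> poisson_mass z k"
  by (simp add: poisson_mass_def)

lemma poisson_mass_eq_0_iff: "poisson_mass z k = 0 \<longleftrightarrow> z = 0 \<and> k \<noteq> 0"
  by (auto simp: poisson_mass_def)

lemma poisson_mass_Suc: "real (Suc k) * poisson_mass z (Suc k) = z * poisson_mass z k"
  by (simp add: poisson_mass_def field_simps del: of_nat_Suc)

lemma has_real_derivative_poisson_mass:
  "((\<lambda>z. poisson_mass z k) has_real_derivative
     (if k = 0 then 0 else poisson_mass z (k - 1)) - poisson_mass z k) (at z within S)"
proof (cases k)
  case 0
  then show ?thesis
    unfolding poisson_mass_def by (auto intro!: derivative_eq_intros)
next
  case (Suc l)
  \<comment> \<open>The factor \<open>Suc l\<close> of the power rule will cancel against the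
    factorial. Nothing is divided by z, so the rate 0 is covered.\<close>
  have "((\<lambda>z. poisson_mass z (Suc l)) has_real_derivative
      real (Suc l) * z ^ l / fact (Suc l) * exp (- z) - poisson_mass z (Suc l)) (at z within S)"
  proof -
    have "((\<lambda>z. z ^ Suc l / fact (Suc l)) has_real_derivative real (Suc l) * z ^ l / fact (Suc l)) (at z within S)"
      using DERIV_cdivide[OF DERIV_pow[of "Suc l" z S], of "fact (Suc l)"] by simp
    moreover have "((\<lambda>z. exp (- z)) has_real_derivative - exp (- z)) (at z within S)"
      by (auto intro!: derivative_eq_intros)
    ultimately show ?thesis
      unfolding poisson_mass_def by (rule DERIV_mult'[THEN DERIV_cong]) (simp add: algebra_simps)
  qed
  moreover have "real (Suc l) * z ^ l / fact (Suc l) * exp (- z) = poisson_mass z l"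
    by (simp add: poisson_mass_def field_simps del: of_nat_Suc)
  ultimately show ?thesis by (simp add: Suc)
qed

abbreviation channel_rate :: "real^'n^'m \<Rightarrow> real^'m \<Rightarrow> real^'n \<Rightarrow> 'm \<Rightarrow> real" where
  "channel_rate \<Phi> lam x i \<equiv> (\<Phi> *v x) $ i + lam $ i"

lemma channel_rate_eq: "channel_rate \<Phi> lam x i = (\<Sum>j\<in>UNIV. \<Phi> $ i $ j * x $ j) + lam $ i"
  by (simp add: matrix_vector_mult_def)

lemma channel_rate_nonneg:
  fixes x :: "real^'n"
  assumes "\<forall>i j. 0 \<le> \<Phi> $ i $ j" "\<forall>i. 0 \<le> lam $ i" "\<forall>j. 0 \<le> x $ j"
  shows "0 \<le> channel_rate \<Phi> lam x i"
  unfolding channel_rate_eq using assms by (intro add_nonneg_nonneg sum_nonneg) auto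

lemma channel_rate_upd_entry:
  "channel_rate (upd_entry \<Phi> i j s) lam x k =
     channel_rate \<Phi> lam x k + (if k = i then (s - \<Phi> $ i $ j) * x $ j else 0)"
proof -
  have "(\<Sum>l\<in>UNIV. upd_entry \<Phi> i j s $ k $ l * x $ l) =
      (\<Sum>l\<in>UNIV. \<Phi> $ k $ l * x $ l + (if l = j then (if k = i then (s - \<Phi> $ i $ j) * x $ j else 0) else 0))"
    by (intro sum.cong) (auto simp: upd_entry_def algebra_simps)
  then show ?thesis
    by (simp add: channel_rate_eq sum.distrib)
qed

lemma upd_entry_same [simp]: "upd_entry \<Phi> i j (\<Phi> $ i $ j) = \<Phi>"
  by (simp add: upd_entry_def vec_eq_iff)

lemma upd_entry_nonneg:
  "\<forall>i j. 0 \<le> \<Phi> $ i $ j \<Longrightarrow> 0 \<le> s \<Longrightarrow> \<forall>k l. 0 \<le> upd_entry \<Phi> i j s $ k $ l"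
  by (simp add: upd_entry_def)

text \<open>Isolates coordinate i: changing row i of the matrix or the i-th entry of the output
  affects the first factor only.\<close>

lemma poisson_channel_mass_split:
  "poisson_channel_mass \<Phi> lam x y =
     poisson_mass (channel_rate \<Phi> lam x i) (y $ i) *
     (\<Prod>k\<in>-{i}. poisson_mass (channel_rate \<Phi> lam x k) (y $ k))"
  unfolding poisson_channel_mass_def
  by (subst prod.remove[of _ i]) (auto simp: Compl_eq_Diff_UNIV)

lemma poisson_channel_mass_nonneg:
  "(\<And>k. 0 \<le> channel_rate \<Phi> lam x k) \<Longrightarrow> 0 \<le> poisson_channel_mass \<Phi> lam x y"
  unfolding poisson_channel_mass_def by (intro prod_nonneg) (auto simp: poisson_mass_nonneg)

text \<open>Pois(0) is the unit mass at 0, while a nonzero rate gives a nonzero value at every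
  count.\<close>

lemma poisson_channel_mass_eq_0_iff:
  "poisson_channel_mass \<Phi> lam x y = 0 \<longleftrightarrow> (\<exists>k. channel_rate \<Phi> lam x k = 0 \<and> y $ k \<noteq> 0)"
  unfolding poisson_channel_mass_def by (auto simp: poisson_mass_eq_0_iff)

lemma poisson_channel_mass_inc_entry:
  "real (Suc (y $ i)) * poisson_channel_mass \<Phi> lam x (inc_entry i y) =
     channel_rate \<Phi> lam x i * poisson_channel_mass \<Phi> lam x y"
proof -
  have "(\<Prod>k\<in>-{i}. poisson_mass (channel_rate \<Phi> lam x k) (inc_entry i y $ k)) =
      (\<Prod>k\<in>-{i}. poisson_mass (channel_rate \<Phi> lam x k) (y $ k))"
    by (intro prod.cong) (auto simp: inc_entry_def)
  then show ?thesis
    unfolding poisson_channel_mass_split[of _ _ _ _ i] mult.assoc[symmetric]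
    by (simp add: poisson_mass_Suc del: of_nat_Suc)
qed

text \<open>The derivative of the mass with respect to the i-th rate. At \<open>y $ i = 0\<close>
  there is no predecessor, and the first term drops out.\<close>

definition channel_mass_diff :: "real^'n^'m \<Rightarrow> real^'m \<Rightarrow> 'm \<Rightarrow> real^'n \<Rightarrow> nat^'m \<Rightarrow> real" where
  "channel_mass_diff \<Phi> lam i x y =
     (if y $ i = 0 then 0 else poisson_channel_mass \<Phi> lam x (dec_entry i y))
     - poisson_channel_mass \<Phi> lam x y"

text \<open>Moving the entry (i, j) changes the rate z_i at speed x_j, so the chain rule multiplies
  the derivative in z_i by x_j.\<close>

lemma has_real_derivative_poisson_channel_mass:
  "((\<lambda>s. poisson_channel_mass (upd_entry \<Phi> i j s) lam x y) has_real_derivative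
     x $ j * channel_mass_diff \<Phi> lam i x y) (at (\<Phi> $ i $ j) within S)"
proof -
  define R where "R = (\<Prod>k\<in>-{i}. poisson_mass (channel_rate \<Phi> lam x k) (y $ k))"
  define z where "z = channel_rate \<Phi> lam x i"
  let ?t = "\<Phi> $ i $ j"
  have eq: "poisson_channel_mass (upd_entry \<Phi> i j s) lam x y =
      poisson_mass (z + (s - ?t) * x $ j) (y $ i) * R" for s
    unfolding poisson_channel_mass_split[of _ _ _ _ i] R_def z_def channel_rate_upd_entry by simp
  have mass: "poisson_channel_mass \<Phi> lam x y = poisson_mass z (y $ i) * R"
    unfolding poisson_channel_mass_split[of _ _ _ _ i] z_def R_def ..
  have "(\<Prod>k\<in>-{i}. poisson_mass (channel_rate \<Phi> lam x k) (dec_entry i y $ k)) = R"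
    unfolding R_def by (intro prod.cong) (auto simp: dec_entry_def)
  then have mass': "poisson_channel_mass \<Phi> lam x (dec_entry i y) = poisson_mass z (y $ i - 1) * R"
    unfolding poisson_channel_mass_split[of _ _ _ _ i] z_def by (simp add: dec_entry_def)
  have "((\<lambda>s. poisson_mass (z + (s - ?t) * x $ j) (y $ i)) has_real_derivative
      ((if y $ i = 0 then 0 else poisson_mass z (y $ i - 1)) - poisson_mass z (y $ i)) * x $ j)
      (at ?t within S)"
    by (rule DERIV_chain'[where f = "\<lambda>s. z + (s - ?t) * x $ j"])
       (auto intro!: derivative_eq_intros has_real_derivative_poisson_mass[THEN DERIV_cong])
  from DERIV_cmult_right[OF this, of R] show ?thesis
    unfolding eq
    by (rule DERIV_cong)
       (auto simp: channel_mass_diff_def mass mass' algebra_simps)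
qed

subsection \<open>The joint law of input and output\<close>

lemma borel_measurable_vec_nth [measurable (raw)]:
  fixes f :: "'a \<Rightarrow> real^'n"
  assumes "f \<in> borel_measurable M"
  shows "(\<lambda>x. f x $ j) \<in> borel_measurable M"
  by (rule borel_measurable_continuous_on[OF _ assms]) (intro continuous_intros)

lemma measurable_channel_mass [measurable (raw)]:
  fixes f :: "'a \<Rightarrow> real^'n"
  assumes [measurable]: "f \<in> borel_measurable M"
  shows "(\<lambda>x. poisson_channel_mass \<Phi> lam (f x) y) \<in> borel_measurable M"
  unfolding poisson_channel_mass_def poisson_mass_def channel_rate_eq by measurable

lemma measurable_pair_count_space:
  fixes f :: "'a \<Rightarrow> 'b::countable \<Rightarrow> 'c"
  assumes "\<And>y. (\<lambda>x. f x y) \<in> measurable M K"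
  shows "(\<lambda>z. f (fst z) (snd z)) \<in> measurable (M \<Otimes>\<^sub>M count_space UNIV) K"
  by (rule measurable_compose_countable[where f = "\<lambda>y z. f (fst z) y"])
     (auto intro: measurable_compose[OF measurable_fst assms])

lemma sigma_finite_count_space: "sigma_finite_measure (count_space (UNIV :: 'b::countable set))"
  by (rule sigma_finite_measure_count_space)

text \<open>A null set times the whole space of \<open>N\<close> is null even when \<open>N\<close>
  is infinite, since 0 * \<infinity> = 0. Below, \<open>N\<close> is counting measure.\<close>

lemma AE_pair_fst:
  assumes "sigma_finite_measure N" "AE x in M. P x"
  shows "AE z in M \<Otimes>\<^sub>M N. P (fst z)"
proof -
  interpret N: sigma_finite_measure N by fact
  obtain A where A: "{x \<in> space M. \<not> P x} \<subseteq> A" "A \<in> null_sets M"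
    using assms(2) by (auto simp: eventually_ae_filter)
  have "A \<times> space N \<in> null_sets (M \<Otimes>\<^sub>M N)"
    using A(2) by (auto simp: null_sets_def N.emeasure_pair_measure_Times)
  then show ?thesis
    by (rule AE_I') (use A(1) in \<open>auto simp: space_pair_measure\<close>)
qed

lemma space_generated_by [simp]: "space (generated_by M Z K) = space M"
  by (simp add: generated_by_def)

lemma subalgebra_generated_by:
  "Z \<in> measurable M K \<Longrightarrow> subalgebra M (generated_by M Z K)"
  unfolding subalgebra_def generated_by_def by (simp add: sets_image_in_sets)

lemma sets_generated_by:
  "Z \<in> measurable M K \<Longrightarrow> sets (generated_by M Z K) = {Z -` A \<inter> space M |A. A \<in> sets K}"
  unfolding generated_by_def by (intro sets_vimage_algebra2) (auto dest: measurable_space)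

text \<open>Regularity is kept out of this locale, so that it can be instantiated at every
  nonnegative matrix and not only at the one where the gradient is taken.\<close>

locale poisson_channel = prob_space M
  for M :: "'a measure" +
  fixes X :: "'a \<Rightarrow> real^'n" and Y :: "'a \<Rightarrow> nat^'m" and \<Phi> :: "real^'n^'m" and lam :: "real^'m"
  assumes X [measurable]: "X \<in> borel_measurable M"
    and X_nonneg: "AE \<omega> in M. \<forall>j. 0 \<le> X \<omega> $ j"
    and \<Phi>_nonneg: "\<forall>i j. 0 \<le> \<Phi> $ i $ j"
    and lam_nonneg: "\<forall>i. 0 \<le> lam $ i"
    and channel: "poisson_channel_output M \<Phi> lam X Y"
begin

abbreviation mass :: "'a \<Rightarrow> nat^'m \<Rightarrow> real" where
  "mass \<omega> \<equiv> poisson_channel_mass \<Phi> lam (X \<omega>)"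

abbreviation outm :: "nat^'m \<Rightarrow> real" where
  "outm \<equiv> output_mass M X \<Phi> lam"

abbreviation Q :: "('a \<times> (nat^'m)) measure" where
  "Q \<equiv> M \<Otimes>\<^sub>M count_space UNIV"

sublocale MN: pair_sigma_finite M "count_space (UNIV :: (nat^'m) set)"
  by (intro pair_sigma_finite.intro sigma_finite_measure_axioms sigma_finite_count_space)

lemma Y [measurable]: "Y \<in> measurable M (count_space UNIV)"
  using channel by (simp add: poisson_channel_output_def)

lemma AE_rate_nonneg: "AE \<omega> in M. \<forall>i. 0 \<le> channel_rate \<Phi> lam (X \<omega>) i"
  using X_nonneg by eventually_elim (simp add: channel_rate_nonneg[OF \<Phi>_nonneg lam_nonneg] del: vector_add_component)

lemma AE_mass_nonneg: "AE \<omega> in M. \<forall>y. 0 \<le> mass \<omega> y"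
  using AE_rate_nonneg by eventually_elim (auto intro: poisson_channel_mass_nonneg)

lemma measurable_mass_pair [measurable]: "(\<lambda>z. mass (fst z) (snd z)) \<in> borel_measurable Q"
  by (rule measurable_pair_count_space) measurable

text \<open>The conditional probability of \<open>Y = y\<close> is integrated over the event
  \<open>X \<in> A\<close>, which lies in the sigma-algebra generated by X. Integrability of the
  mass comes along from \<open>real_cond_exp\<close>, without a bound on the mass.\<close>

lemma
  assumes A: "A \<in> sets borel"
  shows integrable_mass_indicator:
      "integrable M (\<lambda>\<omega>. indicator A (X \<omega>) * mass \<omega> y)"
    and prob_joint_eq_integral_mass:
      "prob {\<omega> \<in> space M. X \<omega> \<in> A \<and> Y \<omega> = y} = (\<integral>\<omega>. indicator A (X \<omega>) * mass \<omega> y \<partial>M)"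
proof -
  note [measurable] = A
  let ?F = "generated_by M X borel"
  interpret F: finite_measure_subalgebra M ?F
    by unfold_locales (simp add: subalgebra_generated_by)
  define S where "S = X -` A \<inter> space M"
  have S: "S \<in> sets ?F"
    unfolding S_def generated_by_def using A by (rule in_vimage_algebra)
  have SM: "S \<in> sets M" unfolding S_def by measurable
  let ?f = "\<lambda>\<omega>. indicator {y} (Y \<omega>) :: real"
  have f: "integrable M ?f"
    by (rule integrable_const_bound[where B = 1]) auto
  have ae: "AE \<omega> in M. real_cond_exp M ?F ?f \<omega> = mass \<omega> y"
    using channel by (simp add: poisson_channel_output_def)
  have ae': "AE \<omega> in M. indicator S \<omega> * real_cond_exp M ?F ?f \<omega> = indicator A (X \<omega>) * mass \<omega> y"
    using ae AE_space by eventually_elim (auto simp: S_def indicator_def)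
  have "integrable M (\<lambda>\<omega>. indicator S \<omega> * real_cond_exp M ?F ?f \<omega>)"
    using integrable_mult_indicator[OF SM F.real_cond_exp_int(1)[OF f]] by simp
  then show "integrable M (\<lambda>\<omega>. indicator A (X \<omega>) * mass \<omega> y)"
    by (rule integrable_cong_AE_imp) (use ae' in \<open>auto simp: eq_commute\<close>)
  have "prob {\<omega> \<in> space M. X \<omega> \<in> A \<and> Y \<omega> = y} = (\<integral>\<omega>. indicator {\<omega> \<in> space M. X \<omega> \<in> A \<and> Y \<omega> = y} \<omega> \<partial>M)"
    by simp
  also have "\<dots> = (\<integral>\<omega>\<in>S. ?f \<omega> \<partial>M)"
    unfolding set_lebesgue_integral_def
    by (rule Bochner_Integration.integral_cong) (auto simp: S_def indicator_def)
  also have "\<dots> = (\<integral>\<omega>\<in>S. real_cond_exp M ?F ?f \<omega> \<partial>M)"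
    by (rule F.real_cond_exp_intA[OF f S])
  also have "\<dots> = (\<integral>\<omega>. indicator A (X \<omega>) * mass \<omega> y \<partial>M)"
    unfolding set_lebesgue_integral_def
    by (rule integral_cong_AE) (use ae' SM in auto)
  finally show "prob {\<omega> \<in> space M. X \<omega> \<in> A \<and> Y \<omega> = y} = (\<integral>\<omega>. indicator A (X \<omega>) * mass \<omega> y \<partial>M)" .
qed

lemma integrable_mass: "integrable M (\<lambda>\<omega>. mass \<omega> y)"
  using integrable_mass_indicator[of UNIV] by simp

lemma prob_output: "prob {\<omega> \<in> space M. Y \<omega> = y} = outm y"
  using prob_joint_eq_integral_mass[of UNIV] by (simp add: output_mass_def)

lemma outm_nonneg: "0 \<le> outm y"
  by (metis prob_output measure_nonneg)

text \<open>A set is cut into its sections at fixed y, and each section is covered by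
  \<open>prob_joint_eq_integral_mass\<close>. The law is described over \<open>Q\<close>, whose
  factors do not depend on the matrix.\<close>

lemma distr_joint:
  "distr M (borel \<Otimes>\<^sub>M count_space UNIV) (\<lambda>\<omega>. (X \<omega>, Y \<omega>)) =
   distr (density Q (\<lambda>z. ennreal (mass (fst z) (snd z)))) (borel \<Otimes>\<^sub>M count_space UNIV)
     (\<lambda>z. (X (fst z), snd z))" (is "?L = ?R")
proof (rule measure_eqI)
  fix B assume "B \<in> sets ?L"
  then have B [measurable]: "B \<in> sets (borel \<Otimes>\<^sub>M count_space UNIV)" by simp
  have sec [measurable]: "{x. (x, y) \<in> B} \<in> sets borel" for y
    using measurable_Pair2'[of y "count_space UNIV" borel, THEN measurable_sets, OF _ B]
    by (simp add: vimage_def)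
  have "emeasure ?L B = (\<integral>\<^sup>+\<omega>. indicator B (X \<omega>, Y \<omega>) \<partial>M)"
    by (subst nn_integral_indicator[symmetric], simp, subst nn_integral_distr) auto
  \<comment> \<open>The inner sum has the single nonzero candidate y = Y(\<omega>); writing it this
    way lets Tonelli bring y outside.\<close>
  also have "\<dots> = (\<integral>\<^sup>+\<omega>. (\<integral>\<^sup>+y. indicator B (X \<omega>, y) * indicator {Y \<omega>} y \<partial>count_space UNIV) \<partial>M)"
    by (simp add: nn_integral_count_space_indicator)
  also have "\<dots> = (\<integral>\<^sup>+y. (\<integral>\<^sup>+\<omega>. indicator B (X \<omega>, y) * indicator {Y \<omega>} y \<partial>M) \<partial>count_space UNIV)"
    by (rule MN.Fubini'[symmetric]) measurable
  also have "\<dots> = (\<integral>\<^sup>+y. (\<integral>\<^sup>+\<omega>. ennreal (mass \<omega> y) * indicator B (X \<omega>, y) \<partial>M) \<partial>count_space UNIV)"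
  proof (rule nn_integral_cong)
    fix y :: "nat^'m"
    let ?A = "{x. (x, y) \<in> B}"
    have "(\<integral>\<^sup>+\<omega>. indicator B (X \<omega>, y) * indicator {Y \<omega>} y \<partial>M) =
        (\<integral>\<^sup>+\<omega>. indicator {\<omega> \<in> space M. X \<omega> \<in> ?A \<and> Y \<omega> = y} \<omega> \<partial>M)"
      by (rule nn_integral_cong) (auto simp: indicator_def)
    also have "\<dots> = ennreal (prob {\<omega> \<in> space M. X \<omega> \<in> ?A \<and> Y \<omega> = y})"
      by (simp add: emeasure_eq_measure)
    also have "\<dots> = (\<integral>\<^sup>+\<omega>. ennreal (indicator ?A (X \<omega>) * mass \<omega> y) \<partial>M)"
      unfolding prob_joint_eq_integral_mass[OF sec]
      by (rule nn_integral_eq_integral[symmetric, OF integrable_mass_indicator[OF sec]])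
         (use AE_mass_nonneg in eventually_elim, simp)
    also have "\<dots> = (\<integral>\<^sup>+\<omega>. ennreal (mass \<omega> y) * indicator B (X \<omega>, y) \<partial>M)"
      by (rule nn_integral_cong) (auto simp: indicator_def)
    finally show "(\<integral>\<^sup>+\<omega>. indicator B (X \<omega>, y) * indicator {Y \<omega>} y \<partial>M) =
      (\<integral>\<^sup>+\<omega>. ennreal (mass \<omega> y) * indicator B (X \<omega>, y) \<partial>M)" .
  qed
  also have "\<dots> = (\<integral>\<^sup>+z. ennreal (mass (fst z) (snd z)) * indicator B (X (fst z), snd z) \<partial>Q)"
    by (subst MN.nn_integral_snd[symmetric]) (auto simp: case_prod_beta)
  also have "\<dots> = emeasure ?R B"
  proof -
    have "emeasure ?R B = (\<integral>\<^sup>+z. indicator B z \<partial>?R)" by simp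
    also have "\<dots> = (\<integral>\<^sup>+z. indicator B (X (fst z), snd z) \<partial>density Q (\<lambda>z. ennreal (mass (fst z) (snd z))))"
      by (rule nn_integral_distr) measurable
    also have "\<dots> = (\<integral>\<^sup>+z. ennreal (mass (fst z) (snd z)) * indicator B (X (fst z), snd z) \<partial>Q)"
      by (rule nn_integral_density) measurable
    finally show ?thesis by simp
  qed
  finally show "emeasure ?L B = emeasure ?R B" .
qed simp

text \<open>Replaces the random output by a free summation variable, which can then be
  shifted.\<close>

lemma
  fixes f :: "(real^'n) \<times> (nat^'m) \<Rightarrow> real"
  assumes f [measurable]: "f \<in> borel_measurable (borel \<Otimes>\<^sub>M count_space UNIV)"
  shows integrable_joint: "integrable M (\<lambda>\<omega>. f (X \<omega>, Y \<omega>)) \<longleftrightarrow>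
      integrable Q (\<lambda>z. mass (fst z) (snd z) * f (X (fst z), snd z))"
    and integral_joint: "(\<integral>\<omega>. f (X \<omega>, Y \<omega>) \<partial>M) =
      (\<integral>z. mass (fst z) (snd z) * f (X (fst z), snd z) \<partial>Q)"
proof -
  have ae: "AE z in Q. 0 \<le> mass (fst z) (snd z)"
    using AE_pair_fst[OF sigma_finite_count_space AE_mass_nonneg] by eventually_elim simp
  have "integrable M (\<lambda>\<omega>. f (X \<omega>, Y \<omega>)) \<longleftrightarrow>
      integrable (distr M (borel \<Otimes>\<^sub>M count_space UNIV) (\<lambda>\<omega>. (X \<omega>, Y \<omega>))) f"
    by (subst integrable_distr_eq) auto
  then show "integrable M (\<lambda>\<omega>. f (X \<omega>, Y \<omega>)) \<longleftrightarrow>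
      integrable Q (\<lambda>z. mass (fst z) (snd z) * f (X (fst z), snd z))"
    unfolding distr_joint using ae
    by (subst (asm) integrable_distr_eq) (auto simp: integrable_real_density)
  have "(\<integral>\<omega>. f (X \<omega>, Y \<omega>) \<partial>M) =
      integral\<^sup>L (distr M (borel \<Otimes>\<^sub>M count_space UNIV) (\<lambda>\<omega>. (X \<omega>, Y \<omega>))) f"
    by (subst integral_distr) auto
  then show "(\<integral>\<omega>. f (X \<omega>, Y \<omega>) \<partial>M) =
      (\<integral>z. mass (fst z) (snd z) * f (X (fst z), snd z) \<partial>Q)"
    unfolding distr_joint using ae
    by (subst (asm) integral_distr) (auto simp: integral_real_density)
qed

lemma distr_output: "distr M (count_space UNIV) Y = density (count_space UNIV) (\<lambda>y. ennreal (outm y))"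
proof (rule measure_eqI_countable[where A = UNIV])
  fix y :: "nat^'m"
  have "emeasure (distr M (count_space UNIV) Y) {y} = ennreal (prob {\<omega> \<in> space M. Y \<omega> = y})"
    by (simp add: emeasure_distr emeasure_eq_measure vimage_def Int_def conj_commute)
  also have "\<dots> = emeasure (density (count_space UNIV) (\<lambda>y. ennreal (outm y))) {y}"
    by (simp add: prob_output emeasure_density nn_integral_count_space_indicator)
  finally show "emeasure (distr M (count_space UNIV) Y) {y} =
    emeasure (density (count_space UNIV) (\<lambda>y. ennreal (outm y))) {y}" .
qed auto

text \<open>The reference measures are the law of X and counting measure. With respect to them X has
  density 1, Y has density \<open>outm\<close>, and the pair has the channel mass as
  density.\<close>

lemma mutual_info_eq:
  "mutual_info M X Y = (\<integral>z. mass (fst z) (snd z) * ln (mass (fst z) (snd z) / outm (snd z)) \<partial>Q)"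
proof -
  interpret I: information_space M "exp 1"
    by unfold_locales simp
  let ?S = "distr M borel X" and ?N = "count_space (UNIV :: (nat^'m) set)"
  interpret S: prob_space ?S by (rule prob_space_distr) simp
  \<comment> \<open>The mass is truncated at 0, because it may be negative outside the nonnegative orthant.\<close>
  define p where "p = (\<lambda>z. max 0 (poisson_channel_mass \<Phi> lam (fst z) (snd z)))"
  have p [measurable]: "p \<in> borel_measurable (borel \<Otimes>\<^sub>M ?N)"
  proof -
    have [measurable]: "(\<lambda>z. poisson_channel_mass \<Phi> lam (fst z) (snd z)) \<in> borel_measurable (borel \<Otimes>\<^sub>M ?N)"
      by (rule measurable_pair_count_space) measurable
    show ?thesis unfolding p_def by measurable
  qed
  have SN: "?S \<Otimes>\<^sub>M ?N = distr Q (borel \<Otimes>\<^sub>M ?N) (\<lambda>z. (X (fst z), snd z))"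
  proof -
    have "?S \<Otimes>\<^sub>M distr ?N ?N (\<lambda>y. y) = distr Q (borel \<Otimes>\<^sub>M ?N) (\<lambda>(\<omega>, y). (X \<omega>, y))"
      by (rule pair_measure_distr) (auto simp: distr_id2 sigma_finite_count_space)
    then show ?thesis by (simp add: distr_id2 case_prod_beta')
  qed
  \<comment> \<open>Mutual information sees its measure arguments only through their sigma-algebras,
    so \<open>borel\<close> may be exchanged for the law of X, a sigma-finite reference
    measure.\<close>
  have "mutual_info M X Y = mutual_information (exp 1) ?S ?N X Y"
    unfolding mutual_info_def mutual_information_def
    by (intro arg_cong2[where f = "KL_divergence (exp 1)"] arg_cong2[where f = "(\<Otimes>\<^sub>M)"] distr_cong refl
         sets_pair_measure_cong) auto
  also have "\<dots> = (\<integral>z. p z * log (exp 1) (p z / (1 * outm (snd z))) \<partial>(?S \<Otimes>\<^sub>M ?N))"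
  proof (rule I.mutual_information_distr)
    show "sigma_finite_measure ?S" "sigma_finite_measure ?N"
      by (rule S.sigma_finite_measure_axioms, rule sigma_finite_count_space)
    show "distributed M ?S X (\<lambda>x. ennreal 1)"
      by (auto simp: distributed_def density_1 intro!: distr_cong)
    show "distributed M ?N Y (\<lambda>y. ennreal (outm y))"
      by (simp add: distributed_def distr_output)
    have "distr M (?S \<Otimes>\<^sub>M ?N) (\<lambda>\<omega>. (X \<omega>, Y \<omega>)) = distr M (borel \<Otimes>\<^sub>M ?N) (\<lambda>\<omega>. (X \<omega>, Y \<omega>))"
      by (intro distr_cong refl sets_pair_measure_cong) auto
    also have "\<dots> = density (?S \<Otimes>\<^sub>M ?N) p"
      unfolding distr_joint SN
      by (subst density_distr) (auto simp: p_def max_def intro!: arg_cong2[where f = "\<lambda>a b. distr a b _"] density_cong simp: ennreal_eq_0_iff)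
    finally show "distributed M (?S \<Otimes>\<^sub>M ?N) (\<lambda>\<omega>. (X \<omega>, Y \<omega>)) (\<lambda>z. ennreal (p z))"
      by (simp add: distributed_def cong: measurable_cong_sets)
  qed (auto simp: outm_nonneg p_def)
  also have "\<dots> = (\<integral>z. p (X (fst z), snd z) * ln (p (X (fst z), snd z) / outm (snd z)) \<partial>Q)"
    unfolding SN by (subst integral_distr) (auto simp: log_def)
  also have "\<dots> = (\<integral>z. mass (fst z) (snd z) * ln (mass (fst z) (snd z) / outm (snd z)) \<partial>Q)"
  proof (rule integral_cong_AE)
    show "AE z in Q. p (X (fst z), snd z) * ln (p (X (fst z), snd z) / outm (snd z)) =
      mass (fst z) (snd z) * ln (mass (fst z) (snd z) / outm (snd z))"
      using AE_pair_fst[OF sigma_finite_count_space AE_mass_nonneg]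
      by eventually_elim (simp add: p_def max_def)
  qed measurable
  finally show ?thesis .
qed

end

section \<open>Fubini, weights and shifts for inputs times outputs\<close>

context poisson_channel
begin

text \<open>Fubini with the output outside. Only the empty set is null for counting measure, so the
  sections are integrable at every y.\<close>

lemma
  fixes f :: "'a \<times> (nat^'m) \<Rightarrow> real"
  assumes f: "integrable Q f"
  shows integrable_section: "integrable M (\<lambda>\<omega>. f (\<omega>, y))"
    and integrable_N: "integrable (count_space UNIV) (\<lambda>y. \<integral>\<omega>. f (\<omega>, y) \<partial>M)"
    and integral_Q_snd: "(\<integral>z. f z \<partial>Q) = (\<integral>y. (\<integral>\<omega>. f (\<omega>, y) \<partial>M) \<partial>count_space UNIV)"
proof -
  interpret NM: pair_sigma_finite "count_space (UNIV :: (nat^'m) set)" M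
    by (intro pair_sigma_finite.intro sigma_finite_measure_axioms sigma_finite_count_space)
  have f': "integrable (count_space UNIV \<Otimes>\<^sub>M M) (\<lambda>(y, \<omega>). f (\<omega>, y))"
    using MN.integrable_product_swap[OF f] by (simp add: case_prod_beta')
  show "integrable M (\<lambda>\<omega>. f (\<omega>, y))"
    using NM.AE_integrable_fst'[OF f'] by (simp add: AE_count_space)
  show "integrable (count_space UNIV) (\<lambda>y. \<integral>\<omega>. f (\<omega>, y) \<partial>M)"
    using NM.integrable_fst'[OF f'] by simp
  show "(\<integral>z. f z \<partial>Q) = (\<integral>y. (\<integral>\<omega>. f (\<omega>, y) \<partial>M) \<partial>count_space UNIV)"
    using NM.integral_fst'[OF f'] MN.integral_product_swap[of f] f by (simp add: case_prod_beta')
qed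

text \<open>The weight \<open>c\<close> may be unbounded, so integrability of \<open>h\<close> alone
  does not suffice; the hypothesis is the Tonelli criterion with y outside. It serves for the output
  score q'/q and for the ratio in \<open>integrable_post_ratio\<close>.\<close>

lemma
  fixes h :: "'a \<times> (nat^'m) \<Rightarrow> real"
  assumes h: "integrable Q h"
    and c: "integrable (count_space UNIV) (\<lambda>y. c y * (\<integral>\<omega>. \<bar>h (\<omega>, y)\<bar> \<partial>M))"
  shows integrable_weight_snd: "integrable Q (\<lambda>z. c (snd z) * h z)"
    and integral_weight_snd:
      "(\<integral>z. c (snd z) * h z \<partial>Q) = (\<integral>y. c y * (\<integral>\<omega>. h (\<omega>, y) \<partial>M) \<partial>count_space UNIV)"
proof -
  interpret NM: pair_sigma_finite "count_space (UNIV :: (nat^'m) set)" M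
    by (intro pair_sigma_finite.intro sigma_finite_measure_axioms sigma_finite_count_space)
  have [measurable]: "h \<in> borel_measurable Q" using h by simp
  have "integrable (count_space UNIV \<Otimes>\<^sub>M M) (\<lambda>w. c (fst w) * h (snd w, fst w))"
  proof (rule NM.Fubini_integrable)
    have "integrable (count_space UNIV) (\<lambda>y. norm (c y * (\<integral>\<omega>. \<bar>h (\<omega>, y)\<bar> \<partial>M)))"
      using c by (rule integrable_norm)
    then show "integrable (count_space UNIV)
        (\<lambda>y. \<integral>\<omega>. norm (c (fst (y, \<omega>)) * h (snd (y, \<omega>), fst (y, \<omega>))) \<partial>M)"
      by (simp add: abs_mult)
    show "AE y in count_space UNIV. integrable M (\<lambda>\<omega>. c (fst (y, \<omega>)) * h (snd (y, \<omega>), fst (y, \<omega>)))"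
      using integrable_section[OF h] by (auto simp: AE_count_space)
  qed measurable
  from NM.integrable_product_swap[OF this] show "integrable Q (\<lambda>z. c (snd z) * h z)"
    by (simp add: case_prod_beta')
  from integral_Q_snd[OF this] show
    "(\<integral>z. c (snd z) * h z \<partial>Q) = (\<integral>y. c y * (\<integral>\<omega>. h (\<omega>, y) \<partial>M) \<partial>count_space UNIV)"
    by simp
qed

text \<open>For each fixed input the sum over y is reindexed by \<open>inc_entry\<close>, which
  undoes the shift.\<close>

lemma
  fixes f :: "'a \<times> (nat^'m) \<Rightarrow> real" and i :: 'm
  assumes f: "integrable Q f"
  defines "g \<equiv> \<lambda>z. if snd z $ i = 0 then 0 else f (fst z, dec_entry i (snd z))"
  shows integrable_dec_entry_Q: "integrable Q g"
    and integral_dec_entry_Q: "(\<integral>z. g z \<partial>Q) = (\<integral>z. f z \<partial>Q)"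
proof -
  have [measurable]: "f \<in> borel_measurable Q" using f by simp
  have g: "g (\<omega>, y) = (if y $ i = 0 then 0 else f (\<omega>, dec_entry i y))" for \<omega> y
    by (simp add: g_def)
  have n: "(\<lambda>y. norm (g (\<omega>, y))) = (\<lambda>y. if y $ i = 0 then 0 else norm (f (\<omega>, dec_entry i y)))" for \<omega>
    by (auto simp: g)
  show I: "integrable Q g"
  proof (rule MN.Fubini_integrable)
    have "(\<lambda>z. if snd z $ i = 0 then 0 else f (fst z, dec_entry i (snd z))) \<in> borel_measurable Q"
      by (rule measurable_pair_count_space[where f = "\<lambda>\<omega> y. if y $ i = 0 then 0 else f (\<omega>, dec_entry i y)"])
         measurable
    then show "g \<in> borel_measurable Q" by (simp add: g_def)
    have "integrable M (\<lambda>\<omega>. \<integral>y. norm (f (\<omega>, y)) \<partial>count_space UNIV)"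
      using MN.integrable_fst'[OF integrable_norm[OF f]] .
    then show "integrable M (\<lambda>\<omega>. \<integral>y. norm (g (\<omega>, y)) \<partial>count_space UNIV)"
      unfolding n integral_inc_entry by simp
    show "AE \<omega> in M. integrable (count_space UNIV) (\<lambda>y. g (\<omega>, y))"
      using MN.AE_integrable_fst'[OF f] unfolding g integrable_inc_entry by simp
  qed
  show "(\<integral>z. g z \<partial>Q) = (\<integral>z. f z \<partial>Q)"
    unfolding MN.integral_fst'[OF I, symmetric] MN.integral_fst'[OF f, symmetric] g integral_inc_entry
    by simp
qed

lemma
  fixes c :: "nat^'m \<Rightarrow> real"
  shows integrable_output:
      "integrable M (\<lambda>\<omega>. c (Y \<omega>)) \<longleftrightarrow> integrable (count_space UNIV) (\<lambda>y. outm y * c y)"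
    and integral_output:
      "(\<integral>\<omega>. c (Y \<omega>) \<partial>M) = (\<integral>y. outm y * c y \<partial>count_space UNIV)"
proof -
  have "integrable M (\<lambda>\<omega>. c (Y \<omega>)) \<longleftrightarrow> integrable (distr M (count_space UNIV) Y) c"
    by (subst integrable_distr_eq) auto
  then show "integrable M (\<lambda>\<omega>. c (Y \<omega>)) \<longleftrightarrow> integrable (count_space UNIV) (\<lambda>y. outm y * c y)"
    unfolding distr_output by (simp add: integrable_real_density outm_nonneg)
  have "(\<integral>\<omega>. c (Y \<omega>) \<partial>M) = integral\<^sup>L (distr M (count_space UNIV) Y) c"
    by (subst integral_distr) auto
  then show "(\<integral>\<omega>. c (Y \<omega>) \<partial>M) = (\<integral>y. outm y * c y \<partial>count_space UNIV)"
    unfolding distr_output by (simp add: integral_real_density outm_nonneg)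
qed

lemma AE_mass_0: "outm y = 0 \<Longrightarrow> AE \<omega> in M. mass \<omega> y = 0"
proof -
  assume "outm y = 0"
  moreover have "AE \<omega> in M. 0 \<le> mass \<omega> y"
    using AE_mass_nonneg by eventually_elim simp
  ultimately show ?thesis
    using integral_nonneg_eq_0_iff_AE[OF integrable_mass[of y]] by (simp add: output_mass_def)
qed

text \<open>There are countably many outputs, so one null set of inputs serves all of them. Off it,
  p / q has a positive denominator wherever p is nonzero.\<close>

lemma AE_outm_pos: "AE \<omega> in M. \<forall>y. mass \<omega> y \<noteq> 0 \<longrightarrow> 0 < outm y"
proof -
  have "AE \<omega> in M. mass \<omega> y \<noteq> 0 \<longrightarrow> 0 < outm y" for y
  proof (cases "outm y = 0")
    case True
    then show ?thesis using AE_mass_0[of y] by auto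
  next
    case False
    then show ?thesis using outm_nonneg[of y] by auto
  qed
  then show ?thesis by (simp add: AE_all_countable)
qed

lemma integrable_mass_Q: "integrable Q (\<lambda>z. mass (fst z) (snd z))"
  using integrable_joint[of "\<lambda>_. 1"] by simp

end

subsection \<open>The conditional mean\<close>

locale integrable_poisson_channel = poisson_channel M X Y \<Phi> lam
  for M :: "'a measure" and X :: "'a \<Rightarrow> real^'n" and Y :: "'a \<Rightarrow> nat^'m"
    and \<Phi> :: "real^'n^'m" and lam :: "real^'m" +
  assumes mean: "integrable M X"
begin

text \<open>The numerator of Bayes' formula, that is, the mean of X_j on the event
  \<open>Y = y\<close>.\<close>

definition weighted_mean :: "'n \<Rightarrow> nat^'m \<Rightarrow> real" where
  "weighted_mean j y = (\<integral>\<omega>. mass \<omega> y * X \<omega> $ j \<partial>M)"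

text \<open>E[X | Y = y] by Bayes' formula; at outputs of probability 0 division by 0 yields
  0.\<close>

definition post_mean :: "nat^'m \<Rightarrow> real^'n" where
  "post_mean y = (\<chi> j. weighted_mean j y / outm y)"

lemma integrable_X: "integrable M (\<lambda>\<omega>. X \<omega> $ j)"
  by (rule integrable_bounded_linear[OF bounded_linear_vec_nth mean])

lemma integrable_mass_X_Q: "integrable Q (\<lambda>z. mass (fst z) (snd z) * X (fst z) $ j)"
  using integrable_joint[of "\<lambda>z. fst z $ j"] integrable_X[of j] by simp

lemma integrable_mass_X: "integrable M (\<lambda>\<omega>. mass \<omega> y * X \<omega> $ j)"
  using integrable_section[OF integrable_mass_X_Q] by simp

lemma integrable_weighted_mean: "integrable (count_space UNIV) (weighted_mean j)"
  using integrable_N[OF integrable_mass_X_Q[of j]] by (simp add: weighted_mean_def[abs_def])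

lemma weighted_mean_eq_0: "outm y = 0 \<Longrightarrow> weighted_mean j y = 0"
  unfolding weighted_mean_def
  by (intro integral_eq_zero_AE) (use AE_mass_0[of y] in \<open>auto elim: AE_mp\<close>)

text \<open>The numerator vanishes at outputs of probability 0, so the denominator cancels at every
  y.\<close>

lemma outm_post_mean: "outm y * post_mean y $ j = weighted_mean j y"
  using weighted_mean_eq_0[of y j] by (cases "outm y = 0") (simp_all add: post_mean_def)

lemma integrable_post_mean: "integrable M (\<lambda>\<omega>. post_mean (Y \<omega>) $ j)"
  unfolding integrable_output[of "\<lambda>y. post_mean y $ j"]
  by (simp add: outm_post_mean integrable_weighted_mean)

text \<open>Over any event \<open>Y \<in> B\<close>, both X_j and the posterior mean integrate to
  the sum of \<open>weighted_mean\<close> over B. From here on an explicit function of the output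
  stands for the conditional mean.\<close>

lemma AE_cond_mean: "AE \<omega> in M. cond_mean M X Y \<omega> = post_mean (Y \<omega>)"
proof -
  let ?F = "generated_by M Y (count_space UNIV)"
  interpret F: finite_measure_subalgebra M ?F
    by unfold_locales (simp add: subalgebra_generated_by)
  have "AE \<omega> in M. real_cond_exp M ?F (\<lambda>\<omega>. X \<omega> $ j) \<omega> = post_mean (Y \<omega>) $ j" for j
  proof (rule F.real_cond_exp_charact)
    fix A assume "A \<in> sets ?F"
    then obtain B where A: "A = Y -` B \<inter> space M"
      unfolding sets_generated_by[OF Y] by auto
    have ind: "indicator A \<omega> = (indicator B (Y \<omega>) :: real)" if "\<omega> \<in> space M" for \<omega>
      using that by (simp add: A indicator_def)
    have "A \<in> sets M" using Y by (simp add: A measurable_sets)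
    from integrable_mult_indicator[OF this integrable_X[of j]]
    have h: "integrable M (\<lambda>\<omega>. indicator B (Y \<omega>) * X \<omega> $ j)"
      by (rule Bochner_Integration.integrable_cong[OF refl, THEN iffD1, rotated]) (simp add: ind)
    have hQ: "integrable Q (\<lambda>z. mass (fst z) (snd z) * (indicator B (snd z) * X (fst z) $ j))"
      using integrable_joint[of "\<lambda>z. indicator B (snd z) * fst z $ j"] h by simp
    have "(\<integral>\<omega>\<in>A. X \<omega> $ j \<partial>M) = (\<integral>\<omega>. indicator B (Y \<omega>) * X \<omega> $ j \<partial>M)"
      unfolding set_lebesgue_integral_def by (rule Bochner_Integration.integral_cong) (simp_all add: ind)
    also have "\<dots> = (\<integral>z. mass (fst z) (snd z) * (indicator B (snd z) * X (fst z) $ j) \<partial>Q)"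
      using integral_joint[of "\<lambda>z. indicator B (snd z) * fst z $ j"] by simp
    also have "\<dots> = (\<integral>y. indicator B y * weighted_mean j y \<partial>count_space UNIV)"
      unfolding integral_Q_snd[OF hQ] weighted_mean_def
      by (simp add: mult.left_commute[of _ "indicator _ _"])
    also have "\<dots> = (\<integral>\<omega>. indicator B (Y \<omega>) * post_mean (Y \<omega>) $ j \<partial>M)"
      using integral_output[of "\<lambda>y. indicator B y * post_mean y $ j"]
      by (simp add: mult.left_commute[of _ "indicator _ _"] outm_post_mean)
    also have "\<dots> = (\<integral>\<omega>\<in>A. post_mean (Y \<omega>) $ j \<partial>M)"
      unfolding set_lebesgue_integral_def by (rule Bochner_Integration.integral_cong) (simp_all add: ind)
    finally show "(\<integral>\<omega>\<in>A. X \<omega> $ j \<partial>M) = (\<integral>\<omega>\<in>A. post_mean (Y \<omega>) $ j \<partial>M)" .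
  next
    have "Y \<in> measurable ?F (count_space UNIV)"
      unfolding generated_by_def by (rule measurable_vimage_algebra1) simp
    then show "(\<lambda>\<omega>. post_mean (Y \<omega>) $ j) \<in> borel_measurable ?F"
      by (rule measurable_compose) simp
  qed (simp_all add: integrable_X integrable_post_mean)
  then have "AE \<omega> in M. \<forall>j. real_cond_exp M ?F (\<lambda>\<omega>. X \<omega> $ j) \<omega> = post_mean (Y \<omega>) $ j"
    by (simp add: AE_all_countable)
  then show ?thesis
    by eventually_elim (simp add: cond_mean_def vec_eq_iff)
qed

lemma integrable_rate: "integrable M (\<lambda>\<omega>. channel_rate \<Phi> lam (X \<omega>) i)"
  unfolding channel_rate_eq
  by (intro Bochner_Integration.integrable_add Bochner_Integration.integrable_sum
      integrable_mult_right integrable_X integrable_const)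

text \<open>The rate is affine in the input, so averaging it against the posterior amounts to
  evaluating it at the posterior mean.\<close>

lemma
  shows integrable_mass_rate: "integrable M (\<lambda>\<omega>. mass \<omega> y * channel_rate \<Phi> lam (X \<omega>) i)"
    and integral_mass_rate:
      "(\<integral>\<omega>. mass \<omega> y * channel_rate \<Phi> lam (X \<omega>) i \<partial>M) = outm y * channel_rate \<Phi> lam (post_mean y) i"
proof -
  have eq: "mass \<omega> y * channel_rate \<Phi> lam (X \<omega>) i =
      (\<Sum>j\<in>UNIV. \<Phi> $ i $ j * (mass \<omega> y * X \<omega> $ j)) + lam $ i * mass \<omega> y" for \<omega>
    unfolding channel_rate_eq by (simp add: algebra_simps sum_distrib_left)
  show "integrable M (\<lambda>\<omega>. mass \<omega> y * channel_rate \<Phi> lam (X \<omega>) i)"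
    unfolding eq
    by (intro Bochner_Integration.integrable_add Bochner_Integration.integrable_sum
        integrable_mult_right integrable_mass_X integrable_mass)
  have "(\<integral>\<omega>. mass \<omega> y * channel_rate \<Phi> lam (X \<omega>) i \<partial>M) =
      (\<Sum>j\<in>UNIV. \<Phi> $ i $ j * weighted_mean j y) + lam $ i * outm y"
    unfolding eq by (simp add: integrable_mass_X integrable_mass weighted_mean_def output_mass_def)
  also have "\<dots> = outm y * channel_rate \<Phi> lam (post_mean y) i"
    unfolding channel_rate_eq outm_post_mean[symmetric] by (simp add: algebra_simps sum_distrib_left)
  finally show "(\<integral>\<omega>. mass \<omega> y * channel_rate \<Phi> lam (X \<omega>) i \<partial>M) =
      outm y * channel_rate \<Phi> lam (post_mean y) i" .
qed

text \<open>The recursion for the mass, integrated over the input. It is Robbins' formula from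
  empirical Bayes: E[z_i(X) | Y = y] = (y_i + 1) q(y + e_i) / q(y).\<close>

lemma outm_inc_entry:
  "real (Suc (y $ i)) * outm (inc_entry i y) = outm y * channel_rate \<Phi> lam (post_mean y) i"
proof -
  have "real (Suc (y $ i)) * outm (inc_entry i y) =
      (\<integral>\<omega>. real (Suc (y $ i)) * mass \<omega> (inc_entry i y) \<partial>M)"
    by (simp add: output_mass_def)
  also have "\<dots> = (\<integral>\<omega>. mass \<omega> y * channel_rate \<Phi> lam (X \<omega>) i \<partial>M)"
    unfolding poisson_channel_mass_inc_entry by (simp add: mult.commute del: vector_add_component)
  finally show ?thesis unfolding integral_mass_rate .
qed

end

section \<open>Positive posterior rates and the term of conditional mean 0\<close>

locale regular_poisson_channel = integrable_poisson_channel M X Y \<Phi> lam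
  for M :: "'a measure" and X :: "'a \<Rightarrow> real^'n" and Y :: "'a \<Rightarrow> nat^'m"
    and \<Phi> :: "real^'n^'m" and lam :: "real^'m" +
  assumes dom: "AE \<omega> in M. cond_mean M X Y \<omega> \<in> poisson_bregman_dom \<Phi> lam"
    and regular: "interchange_regular M X \<Phi> lam"
begin

text \<open>\<open>dom\<close> holds almost surely, so it cannot fail on the event
  \<open>Y = y\<close> of positive probability.\<close>

lemma post_rate_pos:
  assumes "outm y \<noteq> 0"
  shows "0 < channel_rate \<Phi> lam (post_mean y) i"
proof (rule ccontr)
  assume "\<not> ?thesis"
  moreover have "AE \<omega> in M. 0 < channel_rate \<Phi> lam (post_mean (Y \<omega>)) i"
    using dom AE_cond_mean by eventually_elim (simp add: poisson_bregman_dom_def)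
  ultimately have "AE \<omega> in M. Y \<omega> \<noteq> y"
    by (auto elim: AE_mp)
  then have "prob {\<omega> \<in> space M. Y \<omega> = y} = 0"
    by (subst (asm) AE_iff_measurable[OF _ refl]) (auto simp: measure_def)
  then show False using assms by (simp add: prob_output)
qed

lemma outm_inc_entry_pos: "outm y \<noteq> 0 \<Longrightarrow> 0 < outm (inc_entry i y)"
  using outm_inc_entry[of y i] post_rate_pos[of y i] outm_nonneg[of y]
  by (metis less_eq_real_def mult_pos_pos of_nat_0_less_iff zero_less_Suc zero_less_mult_pos)

text \<open>The tower property for a possibly unbounded factor \<open>c\<close>. Since mass and rate
  are nonnegative, the absolute integral over the section at y is q(y) z_i(E[X|Y = y]); this cancels
  the denominator of \<open>c\<close> and leaves the summable \<open>weighted_mean\<close>.\<close>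

lemma
  defines "c \<equiv> \<lambda>j i y. post_mean y $ j / channel_rate \<Phi> lam (post_mean y) i"
  shows integrable_post_ratio: "integrable M (\<lambda>\<omega>. c j i (Y \<omega>) * channel_rate \<Phi> lam (X \<omega>) i)"
    and integral_post_ratio: "(\<integral>\<omega>. c j i (Y \<omega>) * channel_rate \<Phi> lam (X \<omega>) i \<partial>M) =
      (\<integral>\<omega>. post_mean (Y \<omega>) $ j \<partial>M)"
proof -
  define h where "h = (\<lambda>z. mass (fst z) (snd z) * channel_rate \<Phi> lam (X (fst z)) i)"
  have [measurable]: "(\<lambda>z. channel_rate \<Phi> lam (fst z) i) \<in> borel_measurable (borel \<Otimes>\<^sub>M count_space UNIV)"
    unfolding channel_rate_eq by measurable
  have m: "(\<lambda>z. c j i (snd z) * channel_rate \<Phi> lam (fst z) i) \<in> borel_measurable (borel \<Otimes>\<^sub>M count_space UNIV)"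
    by (intro borel_measurable_times measurable_compose[OF measurable_snd]) auto
  have h: "integrable Q h"
    using integrable_joint[of "\<lambda>z. channel_rate \<Phi> lam (fst z) i"] integrable_rate[of i]
    by (simp add: h_def)
  have abs_h: "(\<integral>\<omega>. \<bar>h (\<omega>, y)\<bar> \<partial>M) = outm y * channel_rate \<Phi> lam (post_mean y) i" for y
    unfolding integral_mass_rate[symmetric]
  proof (rule integral_cong_AE)
    show "AE \<omega> in M. \<bar>h (\<omega>, y)\<bar> = mass \<omega> y * channel_rate \<Phi> lam (X \<omega>) i"
      using AE_mass_nonneg AE_rate_nonneg
      by eventually_elim (auto simp: h_def simp del: vector_add_component)
  qed (use integrable_section[OF h] integrable_mass_rate in auto)
  have eq: "c j i y * (outm y * channel_rate \<Phi> lam (post_mean y) i) = weighted_mean j y" for y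
    using post_rate_pos[of y i] outm_post_mean[of y j]
    by (cases "outm y = 0") (simp_all add: c_def weighted_mean_eq_0 mult.commute del: vector_add_component)
  have I: "integrable Q (\<lambda>z. c j i (snd z) * h z)"
    by (rule integrable_weight_snd[OF h]) (simp add: abs_h eq integrable_weighted_mean)
  have "(\<integral>z. c j i (snd z) * h z \<partial>Q) =
      (\<integral>y. c j i y * (\<integral>\<omega>. h (\<omega>, y) \<partial>M) \<partial>count_space UNIV)"
    by (rule integral_weight_snd[OF h]) (simp add: abs_h eq integrable_weighted_mean)
  also have "\<dots> = (\<integral>y. weighted_mean j y \<partial>count_space UNIV)"
    by (simp add: h_def integral_mass_rate eq)
  also have "\<dots> = (\<integral>\<omega>. post_mean (Y \<omega>) $ j \<partial>M)"
    unfolding integral_output[of "\<lambda>y. post_mean y $ j"] by (simp add: outm_post_mean)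
  finally have J: "(\<integral>z. c j i (snd z) * h z \<partial>Q) = (\<integral>\<omega>. post_mean (Y \<omega>) $ j \<partial>M)" .
  show "integrable M (\<lambda>\<omega>. c j i (Y \<omega>) * channel_rate \<Phi> lam (X \<omega>) i)"
    using I by (simp add: h_def integrable_joint[OF m, simplified fst_conv snd_conv] mult.left_commute del: vector_add_component)
  show "(\<integral>\<omega>. c j i (Y \<omega>) * channel_rate \<Phi> lam (X \<omega>) i \<partial>M) = (\<integral>\<omega>. post_mean (Y \<omega>) $ j \<partial>M)"
    using J by (simp add: h_def integral_joint[OF m, simplified fst_conv snd_conv] mult.left_commute del: vector_add_component)
qed

end

subsection \<open>Derivatives in one entry of the scaling matrix\<close>

text \<open>Makes derivatives within the half-line unique, including the one-sided derivative at an
  entry 0.\<close>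

lemma at_within_nonneg_neq_bot: "0 \<le> t \<Longrightarrow> at (t :: real) within {0..} \<noteq> bot"
  using at_le[of "{t<..}" "{0..}" t] trivial_limit_at_right_real[of t]
  by (auto simp: bot.extremum_unique subset_eq)

lemma has_real_derivative_mult_ln_divide:
  fixes u v :: "real \<Rightarrow> real"
  assumes "(u has_real_derivative u') (at t within S)" "(v has_real_derivative v') (at t within S)"
    and "0 < u t" "0 < v t"
  shows "((\<lambda>s. u s * ln (u s / v s)) has_real_derivative
    u' * (ln (u t / v t) + 1) - u t * (v' / v t)) (at t within S)"
  using assms by (auto intro!: derivative_eq_intros simp: field_simps)

context regular_poisson_channel
begin

abbreviation mass_at :: "'m \<Rightarrow> 'n \<Rightarrow> real \<Rightarrow> 'a \<Rightarrow> nat^'m \<Rightarrow> real" where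
  "mass_at i j s \<omega> \<equiv> poisson_channel_mass (upd_entry \<Phi> i j s) lam (X \<omega>)"

abbreviation outm_at :: "'m \<Rightarrow> 'n \<Rightarrow> real \<Rightarrow> nat^'m \<Rightarrow> real" where
  "outm_at i j s \<equiv> output_mass M X (upd_entry \<Phi> i j s) lam"

definition info_at :: "'m \<Rightarrow> 'n \<Rightarrow> real \<Rightarrow> 'a \<Rightarrow> nat^'m \<Rightarrow> real" where
  "info_at i j s \<omega> y = mass_at i j s \<omega> y * ln (mass_at i j s \<omega> y / outm_at i j s y)"

definition dmass :: "'m \<Rightarrow> 'n \<Rightarrow> 'a \<Rightarrow> nat^'m \<Rightarrow> real" where
  "dmass i j \<omega> y = X \<omega> $ j * channel_mass_diff \<Phi> lam i (X \<omega>) y"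

definition doutm :: "'m \<Rightarrow> 'n \<Rightarrow> nat^'m \<Rightarrow> real" where
  "doutm i j y = (\<integral>\<omega>. dmass i j \<omega> y \<partial>M)"

definition info_density :: "'a \<Rightarrow> nat^'m \<Rightarrow> real" where
  "info_density \<omega> y = ln (mass \<omega> y / outm y)"

lemma nontrivial: "at (\<Phi> $ i $ j) within {0..} \<noteq> bot"
  using \<Phi>_nonneg by (intro at_within_nonneg_neq_bot) simp

lemma measurable_dmass [measurable]: "(\<lambda>\<omega>. dmass i j \<omega> y) \<in> borel_measurable M"
  unfolding dmass_def channel_mass_diff_def by measurable

lemma measurable_info_density [measurable]: "(\<lambda>\<omega>. info_density \<omega> y) \<in> borel_measurable M"
  unfolding info_density_def by measurable

lemma measurable_dmass_pair [measurable]: "(\<lambda>z. dmass i j (fst z) (snd z)) \<in> borel_measurable Q"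
  by (rule measurable_pair_count_space) measurable

lemma measurable_info_density_pair [measurable]:
  "(\<lambda>z. info_density (fst z) (snd z)) \<in> borel_measurable Q"
  by (rule measurable_pair_count_space) measurable

lemma has_real_derivative_mass_at:
  "((\<lambda>s. mass_at i j s \<omega> y) has_real_derivative dmass i j \<omega> y) (at (\<Phi> $ i $ j) within S)"
  unfolding dmass_def by (rule has_real_derivative_poisson_channel_mass)

lemma has_real_derivative_outm_at:
  "((\<lambda>s. outm_at i j s y) has_real_derivative doutm i j y) (at (\<Phi> $ i $ j) within {0..})"
proof -
  have "deriv_integral_interchange M (\<lambda>s \<omega>. mass_at i j s \<omega> y) (\<Phi> $ i $ j)"
    using regular by (simp add: interchange_regular_def)
  then obtain g' where g': "AE \<omega> in M. ((\<lambda>s. mass_at i j s \<omega> y) has_real_derivative g' \<omega>) (at (\<Phi> $ i $ j) within {0..})"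
    "integrable M g'"
    "((\<lambda>s. \<integral>\<omega>. mass_at i j s \<omega> y \<partial>M) has_real_derivative (\<integral>\<omega>. g' \<omega> \<partial>M)) (at (\<Phi> $ i $ j) within {0..})"
    unfolding deriv_integral_interchange_def by blast
  \<comment> \<open>The interchange hypothesis provides only some derivative \<open>g'\<close>;
    uniqueness identifies it with \<open>dmass\<close> almost everywhere.\<close>
  have "(\<integral>\<omega>. g' \<omega> \<partial>M) = doutm i j y"
    unfolding doutm_def
  proof (rule integral_cong_AE)
    show "AE \<omega> in M. g' \<omega> = dmass i j \<omega> y"
      using g'(1)
      by eventually_elim (rule has_field_derivative_unique[OF _ has_real_derivative_mass_at nontrivial])
  qed (use g'(2) in auto)
  with g'(3) show ?thesis by (simp add: output_mass_def)
qed


lemma info_interchange: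
  "deriv_integral_interchange Q (\<lambda>s z. info_at i j s (fst z) (snd z)) (\<Phi> $ i $ j)"
  using regular unfolding interchange_regular_def info_at_def case_prod_beta' by blast

lemma integrable_info: "integrable Q (\<lambda>z. mass (fst z) (snd z) * info_density (fst z) (snd z))"
  using info_interchange
  by (simp add: deriv_integral_interchange_def info_at_def info_density_def)

text \<open>Almost everywhere for \<open>Q\<close> means at every output, for almost every input.
  This permits evaluation at one chosen output.\<close>

lemma info_derivative:
  obtains g' where
    "AE \<omega> in M. \<forall>y. ((\<lambda>s. info_at i j s \<omega> y) has_real_derivative g' (\<omega>, y)) (at (\<Phi> $ i $ j) within {0..})"
    "integrable Q g'"
    "((\<lambda>s. \<integral>z. info_at i j s (fst z) (snd z) \<partial>Q) has_real_derivative (\<integral>z. g' z \<partial>Q))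
      (at (\<Phi> $ i $ j) within {0..})"
proof -
  from info_interchange[of i j] obtain g' where g':
    "AE z in Q. ((\<lambda>s. info_at i j s (fst z) (snd z)) has_real_derivative g' z) (at (\<Phi> $ i $ j) within {0..})"
    "integrable Q g'"
    "((\<lambda>s. \<integral>z. info_at i j s (fst z) (snd z) \<partial>Q) has_real_derivative (\<integral>z. g' z \<partial>Q))
      (at (\<Phi> $ i $ j) within {0..})"
    unfolding deriv_integral_interchange_def by blast
  show thesis
    using MN.AE_pair[OF g'(1)] by (intro that[OF _ g'(2,3)]) (simp add: AE_count_space)
qed

text \<open>
  If the rate of channel i vanishes while the j-th input does not, then the (i, j) entry is 0 and
  at the output e_i, whose probability is positive, the difference quotient of p ln (p / q) at 0
  behaves like ln s. The assumed differentiability therefore excludes this case.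
\<close>

lemma AE_input_0:
  "AE \<omega> in M. channel_rate \<Phi> lam (X \<omega>) i = 0 \<longrightarrow> X \<omega> $ j = 0"
proof -
  let ?t = "\<Phi> $ i $ j" and ?y = "inc_entry i 0"
  \<comment> \<open>The output 0 has nonzero mass under every input, and adding e_i keeps the
    probability positive.\<close>
  have "outm 0 \<noteq> 0"
    using AE_mass_0[of 0] by (auto simp: poisson_channel_mass_eq_0_iff)
  then have q0: "0 < outm ?y"
    by (rule outm_inc_entry_pos)
  obtain g' where g': "AE \<omega> in M. \<forall>y. ((\<lambda>s. info_at i j s \<omega> y) has_real_derivative g' (\<omega>, y)) (at ?t within {0..})"
    using info_derivative[of i j] by blast
  from g' X_nonneg show ?thesis
  proof eventually_elim
    fix \<omega>
    assume der: "\<forall>y. ((\<lambda>s. info_at i j s \<omega> y) has_real_derivative g' (\<omega>, y)) (at ?t within {0..})"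
      and x: "\<forall>j. 0 \<le> X \<omega> $ j"
    show "channel_rate \<Phi> lam (X \<omega>) i = 0 \<longrightarrow> X \<omega> $ j = 0"
    proof (intro impI, rule ccontr)
      assume rate: "channel_rate \<Phi> lam (X \<omega>) i = 0" and xj: "X \<omega> $ j \<noteq> 0"
      have "\<Phi> $ i $ j * X \<omega> $ j \<le> (\<Sum>l\<in>UNIV. \<Phi> $ i $ l * X \<omega> $ l)"
        using \<Phi>_nonneg x by (intro member_le_sum) auto
      also have "\<dots> \<le> 0"
        using rate lam_nonneg[rule_format, of i] unfolding channel_rate_eq by simp
      finally have t: "?t = 0"
        using \<Phi>_nonneg x xj by (metis less_eq_real_def mult_pos_pos not_le)
      let ?F = "at (0::real) within {0..}"
      let ?u = "\<lambda>s. mass_at i j s \<omega> ?y" and ?v = "\<lambda>s. outm_at i j s ?y"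
      define d where "d = dmass i j \<omega> ?y"
      define D where "D = g' (\<omega>, ?y)"
      have nt: "?F \<noteq> bot" using nontrivial[of i j] by (simp add: t)
      have upd0: "upd_entry \<Phi> i j 0 = \<Phi>" using upd_entry_same[of \<Phi> i j] by (simp add: t)
      have u0: "?u 0 = 0"
        by (simp add: poisson_channel_mass_eq_0_iff upd0 del: vector_add_component)
           (use rate in \<open>auto intro!: exI[of _ i]\<close>)
      have "d = X \<omega> $ j * mass \<omega> 0"
        using u0 by (simp add: d_def dmass_def channel_mass_diff_def upd0)
      then have d: "d \<noteq> 0"
        using xj by (simp add: poisson_channel_mass_eq_0_iff)
      have du: "(?u has_real_derivative d) ?F"
        using has_real_derivative_mass_at[of i j \<omega> ?y "{0..}"] by (simp add: t d_def)
      have dv: "(?v has_real_derivative doutm i j ?y) ?F"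
        using has_real_derivative_outm_at[of i j ?y] by (simp add: t)
      have dF: "((\<lambda>s. info_at i j s \<omega> ?y) has_real_derivative D) ?F"
        using der by (simp add: t D_def)
      have u_pos: "eventually (\<lambda>s. s \<noteq> 0 \<and> 0 < ?u s) ?F"
        unfolding eventually_at_filter
      proof (intro always_eventually allI impI)
        fix s :: real assume s: "s \<noteq> 0" "s \<in> {0..}"
        have "0 \<le> ?u s"
          using s x upd_entry_nonneg[OF \<Phi>_nonneg, of s i j] lam_nonneg
          by (intro poisson_channel_mass_nonneg channel_rate_nonneg) auto
        moreover have "?u s \<noteq> 0"
          unfolding poisson_channel_mass_eq_0_iff channel_rate_upd_entry
          using rate xj s by (auto simp: inc_entry_def t)
        ultimately show "s \<noteq> 0 \<and> 0 < ?u s" using s by simp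
      qed
      have u_lim: "(?u \<longlongrightarrow> 0) ?F"
        using DERIV_continuous[OF du] u0 by (simp add: continuous_within)
      have v_lim: "(?v \<longlongrightarrow> outm ?y) ?F"
        using DERIV_continuous[OF dv] by (simp add: continuous_within upd0)
      have v_pos: "eventually (\<lambda>s. 0 < ?v s) ?F"
        using order_tendstoD(1)[OF v_lim q0] .
      \<comment> \<open>The factor s cancels, so the quotient of the two difference quotients is ln
        (u / v). As d is nonzero, this logarithm would have a finite limit, whereas u / v tends to
        0.\<close>
      have "((\<lambda>s. (info_at i j s \<omega> ?y / s) / (?u s / s)) \<longlongrightarrow> D / d) ?F"
        using dF du d u0 unfolding has_field_derivative_iff
        by (intro tendsto_divide) (simp_all add: info_at_def)
      then have "((\<lambda>s. ln (?u s / ?v s)) \<longlongrightarrow> D / d) ?F"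
        by (rule Lim_transform_eventually)
           (use u_pos in eventually_elim, simp add: info_at_def)
      then have "((\<lambda>s. exp (ln (?u s / ?v s))) \<longlongrightarrow> exp (D / d)) ?F"
        by (rule tendsto_exp)
      then have "((\<lambda>s. ?u s / ?v s) \<longlongrightarrow> exp (D / d)) ?F"
        by (rule Lim_transform_eventually)
           (use u_pos v_pos in eventually_elim, simp)
      moreover have "((\<lambda>s. ?u s / ?v s) \<longlongrightarrow> 0 / outm ?y) ?F"
        using u_lim v_lim q0 by (intro tendsto_divide) auto
      ultimately have "exp (D / d) = 0"
        using tendsto_unique[OF nt] by fastforce
      then show False by simp
    qed
  qed
qed

text \<open>Where the mass is positive this is the product and quotient rule. Where it is 0, it
  stays 0 along the whole line through the entry (i, j), so the function and every term of the
  formula vanish.\<close>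

lemma AE_info_derivative:
  "AE \<omega> in M. \<forall>y.
     (mass \<omega> y = 0 \<longrightarrow> dmass i j \<omega> y = 0) \<and>
     ((\<lambda>s. info_at i j s \<omega> y) has_real_derivative
       dmass i j \<omega> y * info_density \<omega> y + dmass i j \<omega> y - doutm i j y / outm y * mass \<omega> y)
       (at (\<Phi> $ i $ j) within {0..})"
  using AE_input_0[of i j] AE_outm_pos AE_mass_nonneg
proof eventually_elim
  fix \<omega>
  assume *: "channel_rate \<Phi> lam (X \<omega>) i = 0 \<longrightarrow> X \<omega> $ j = 0"
    and q: "\<forall>y. mass \<omega> y \<noteq> 0 \<longrightarrow> 0 < outm y" and p: "\<forall>y. 0 \<le> mass \<omega> y"
  show "\<forall>y. (mass \<omega> y = 0 \<longrightarrow> dmass i j \<omega> y = 0) \<and>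
     ((\<lambda>s. info_at i j s \<omega> y) has_real_derivative
       dmass i j \<omega> y * info_density \<omega> y + dmass i j \<omega> y - doutm i j y / outm y * mass \<omega> y)
       (at (\<Phi> $ i $ j) within {0..})"
  proof
    fix y
    show "(mass \<omega> y = 0 \<longrightarrow> dmass i j \<omega> y = 0) \<and>
     ((\<lambda>s. info_at i j s \<omega> y) has_real_derivative
       dmass i j \<omega> y * info_density \<omega> y + dmass i j \<omega> y - doutm i j y / outm y * mass \<omega> y)
       (at (\<Phi> $ i $ j) within {0..})"
    proof (cases "mass \<omega> y = 0")
      case True
      then obtain k where k: "channel_rate \<Phi> lam (X \<omega>) k = 0" "y $ k \<noteq> 0"
        unfolding poisson_channel_mass_eq_0_iff by blast
      \<comment> \<open>For k different from i the rate does not contain the entry; for k = i the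
        fact \<open>*\<close> gives x_j = 0.\<close>
      then have "channel_rate (upd_entry \<Phi> i j s) lam (X \<omega>) k = 0" for s
        unfolding channel_rate_upd_entry using * by auto
      then have 0: "mass_at i j s \<omega> y = 0" for s
        unfolding poisson_channel_mass_eq_0_iff using k(2) by blast
      have "dmass i j \<omega> y = 0"
        using has_field_derivative_unique[OF has_real_derivative_mass_at[of i j \<omega> y "{0..}"] _ nontrivial]
        unfolding 0 by auto
      then show ?thesis by (simp add: info_at_def 0 True)
    next
      case False
      then have "0 < mass \<omega> y" "0 < outm y" using p q by (simp_all add: less_le)
      then show ?thesis
        using has_real_derivative_mult_ln_divide[OF has_real_derivative_mass_at[of i j \<omega> y "{0..}"]
          has_real_derivative_outm_at[of i j y]]
        by (simp add: info_at_def info_density_def algebra_simps)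
    qed
  qed
qed

text \<open>\<open>dmass\<close> is a shifted copy of x_j p minus x_j p itself. The finite mean of X
  makes both integrable, and the shift preserves the integral.\<close>

lemma
  shows integrable_dmass_Q: "integrable Q (\<lambda>z. dmass i j (fst z) (snd z))"
    and integral_dmass_Q: "(\<integral>z. dmass i j (fst z) (snd z) \<partial>Q) = 0"
proof -
  let ?f = "\<lambda>z. mass (fst z) (snd z) * X (fst z) $ j"
  let ?g = "\<lambda>z. if snd z $ i = 0 then 0 else ?f (fst z, dec_entry i (snd z))"
  note f = integrable_mass_X_Q[of j]
  have eq: "(\<lambda>z. dmass i j (fst z) (snd z)) = (\<lambda>z. ?g z - ?f z)"
    by (auto simp: dmass_def channel_mass_diff_def algebra_simps)
  show "integrable Q (\<lambda>z. dmass i j (fst z) (snd z))"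
    unfolding eq by (rule Bochner_Integration.integrable_diff[OF integrable_dec_entry_Q[OF f] f])
  show "(\<integral>z. dmass i j (fst z) (snd z) \<partial>Q) = 0"
    unfolding eq
    by (subst Bochner_Integration.integral_diff[OF integrable_dec_entry_Q[OF f] f])
       (simp only: integral_dec_entry_Q[OF f] diff_self)
qed

lemma integrable_doutm: "integrable (count_space UNIV) (doutm i j)"
  using integrable_N[OF integrable_dmass_Q[of i j]] by (simp add: doutm_def[abs_def])

lemma integral_doutm: "(\<integral>y. doutm i j y \<partial>count_space UNIV) = 0"
  using integral_Q_snd[OF integrable_dmass_Q[of i j]] by (simp add: doutm_def integral_dmass_Q)

lemma doutm_eq_0: "outm y = 0 \<Longrightarrow> doutm i j y = 0"
  unfolding doutm_def
proof (rule integral_eq_zero_AE)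
  assume "outm y = 0"
  from AE_mass_0[OF this] AE_info_derivative[of i j] show "AE \<omega> in M. dmass i j \<omega> y = 0"
    by eventually_elim blast
qed

text \<open>The output score has mean 0. Integrating p over the input first turns q'/q into q', also
  at outputs of probability 0 by \<open>doutm_eq_0\<close>, and q' sums to 0.\<close>

lemma
  shows integrable_score: "integrable Q (\<lambda>z. doutm i j (snd z) / outm (snd z) * mass (fst z) (snd z))"
    and integral_score: "(\<integral>z. doutm i j (snd z) / outm (snd z) * mass (fst z) (snd z) \<partial>Q) = 0"
proof -
  have "(\<integral>\<omega>. \<bar>mass \<omega> y\<bar> \<partial>M) = outm y" for y
    unfolding output_mass_def
    by (rule integral_cong_AE) (use AE_mass_nonneg in \<open>auto elim: AE_mp\<close>)
  then have c: "doutm i j y / outm y * (\<integral>\<omega>. \<bar>mass \<omega> y\<bar> \<partial>M) = doutm i j y"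
    and c': "doutm i j y / outm y * (\<integral>\<omega>. mass \<omega> y \<partial>M) = doutm i j y" for y
    using doutm_eq_0[of y i j] by (auto simp: output_mass_def[symmetric])
  show "integrable Q (\<lambda>z. doutm i j (snd z) / outm (snd z) * mass (fst z) (snd z))"
    by (rule integrable_weight_snd[OF integrable_mass_Q]) (simp add: c integrable_doutm del: times_divide_eq_left)
  show "(\<integral>z. doutm i j (snd z) / outm (snd z) * mass (fst z) (snd z) \<partial>Q) = 0"
    by (subst integral_weight_snd[OF integrable_mass_Q, of "\<lambda>y. doutm i j y / outm y"])
       (simp_all add: c c' integrable_doutm integral_doutm del: times_divide_eq_left)
qed

text \<open>Integrability of p' L is obtained by solving the formula of
  \<open>AE_info_derivative\<close> for it: the other three terms are integrable, and two of them
  have integral 0.\<close>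

lemma
  shows integrable_dmass_info: "integrable Q (\<lambda>z. dmass i j (fst z) (snd z) * info_density (fst z) (snd z))"
    and has_real_derivative_info:
      "((\<lambda>s. \<integral>z. info_at i j s (fst z) (snd z) \<partial>Q) has_real_derivative
         (\<integral>z. dmass i j (fst z) (snd z) * info_density (fst z) (snd z) \<partial>Q))
       (at (\<Phi> $ i $ j) within {0..})"
proof -
  obtain g' where g':
    "AE \<omega> in M. \<forall>y. ((\<lambda>s. info_at i j s \<omega> y) has_real_derivative g' (\<omega>, y)) (at (\<Phi> $ i $ j) within {0..})"
    "integrable Q g'"
    "((\<lambda>s. \<integral>z. info_at i j s (fst z) (snd z) \<partial>Q) has_real_derivative (\<integral>z. g' z \<partial>Q))
      (at (\<Phi> $ i $ j) within {0..})"
    by (rule info_derivative)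
  let ?a = "\<lambda>z. dmass i j (fst z) (snd z) * info_density (fst z) (snd z)"
  let ?b = "\<lambda>z. dmass i j (fst z) (snd z)"
  let ?c = "\<lambda>z. doutm i j (snd z) / outm (snd z) * mass (fst z) (snd z)"
  have "AE \<omega> in M. \<forall>y. g' (\<omega>, y) = ?a (\<omega>, y) + ?b (\<omega>, y) - ?c (\<omega>, y)"
    using g'(1) AE_info_derivative[of i j]
    by eventually_elim (auto intro: has_field_derivative_unique[OF _ _ nontrivial])
  from AE_pair_fst[OF sigma_finite_count_space this]
  have ae: "AE z in Q. ?a z = g' z - ?b z + ?c z"
  proof eventually_elim
    case (elim z)
    from spec[OF this, of "snd z"] show ?case by simp
  qed
  have I: "integrable Q (\<lambda>z. g' z - ?b z + ?c z)"
    using g'(2) integrable_dmass_Q integrable_score by auto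
  have [measurable]: "g' \<in> borel_measurable Q" using g'(2) by simp
  show "integrable Q ?a"
    by (rule integrable_cong_AE_imp[OF I]) (use ae in \<open>auto elim: AE_mp\<close>)
  have "(\<integral>z. ?a z \<partial>Q) = (\<integral>z. g' z - ?b z + ?c z \<partial>Q)"
    by (rule integral_cong_AE) (use ae I in auto)
  also have "\<dots> = (\<integral>z. g' z \<partial>Q)"
    using g'(2) integrable_dmass_Q[of i j] integrable_score[of i j]
      integral_dmass_Q[of i j] integral_score[of i j] by simp
  finally show "((\<lambda>s. \<integral>z. info_at i j s (fst z) (snd z) \<partial>Q) has_real_derivative (\<integral>z. ?a z \<partial>Q))
       (at (\<Phi> $ i $ j) within {0..})"
    using g'(3) by simp
qed

text \<open>
  Summation by parts in the i-th output coordinate. For almost every input the series with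
  terms p ln (p / q) converges absolutely, which justifies splitting the differences.
\<close>

lemma integral_dmass_info:
  assumes H: "integrable Q (\<lambda>z. mass (fst z) (snd z) * X (fst z) $ j *
      (info_density (fst z) (inc_entry i (snd z)) - info_density (fst z) (snd z)))"
  shows "(\<integral>z. dmass i j (fst z) (snd z) * info_density (fst z) (snd z) \<partial>Q) =
    (\<integral>z. mass (fst z) (snd z) * X (fst z) $ j *
      (info_density (fst z) (inc_entry i (snd z)) - info_density (fst z) (snd z)) \<partial>Q)"
proof -
  have meas: "(\<lambda>\<omega>. \<integral>y. f (\<omega>, y) \<partial>count_space UNIV) \<in> borel_measurable M"
    if "integrable Q f" for f :: "'a \<times> (nat^'m) \<Rightarrow> real"
    using MN.integrable_fst'[OF that] by simp
  show ?thesis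
    \<comment> \<open>The input goes outside, because x_j p L is summable over y for almost every
      fixed input but is not known to be integrable over \<open>Q\<close>.\<close>
    unfolding MN.integral_fst'[OF H, symmetric] MN.integral_fst'[OF integrable_dmass_info, symmetric]
  proof (rule integral_cong_AE[OF meas[OF integrable_dmass_info] meas[OF H]])
    show "AE \<omega> in M. (\<integral>y. dmass i j (fst (\<omega>, y)) (snd (\<omega>, y)) * info_density (fst (\<omega>, y)) (snd (\<omega>, y)) \<partial>count_space UNIV) =
      (\<integral>y. mass (fst (\<omega>, y)) (snd (\<omega>, y)) * X (fst (\<omega>, y)) $ j *
        (info_density (fst (\<omega>, y)) (inc_entry i (snd (\<omega>, y))) - info_density (fst (\<omega>, y)) (snd (\<omega>, y))) \<partial>count_space UNIV)"
      using MN.AE_integrable_fst'[OF integrable_info] MN.AE_integrable_fst'[OF H]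
    proof eventually_elim
      fix \<omega>
      let ?N = "count_space (UNIV :: (nat^'m) set)"
      let ?p = "mass \<omega>" and ?L = "info_density \<omega>" and ?x = "X \<omega> $ j"
      assume "integrable ?N (\<lambda>y. mass (fst (\<omega>, y)) (snd (\<omega>, y)) * info_density (fst (\<omega>, y)) (snd (\<omega>, y)))"
      then have 1: "integrable ?N (\<lambda>y. ?x * (?p y * ?L y))" by simp
      assume "integrable ?N (\<lambda>y. mass (fst (\<omega>, y)) (snd (\<omega>, y)) * X (fst (\<omega>, y)) $ j *
        (info_density (fst (\<omega>, y)) (inc_entry i (snd (\<omega>, y))) - info_density (fst (\<omega>, y)) (snd (\<omega>, y))))"
      then have 2: "integrable ?N (\<lambda>y. ?p y * ?x * (?L (inc_entry i y) - ?L y))" by simp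
      \<comment> \<open>Adding x_j p L back to the difference isolates the shifted term, whose
        summability is not given separately.\<close>
      from Bochner_Integration.integrable_add[OF 2 1]
      have 3: "integrable ?N (\<lambda>y. ?p y * ?x * ?L (inc_entry i y))"
        by (simp add: algebra_simps)
      let ?h = "\<lambda>y. ?p (dec_entry i y) * ?x * ?L y"
      have 4: "integrable ?N (\<lambda>y. if y $ i = 0 then 0 else ?h y)"
        unfolding integrable_inc_entry using 3 by simp
      have "(\<integral>y. dmass i j \<omega> y * ?L y \<partial>?N) =
          (\<integral>y. (if y $ i = 0 then 0 else ?h y) - ?x * (?p y * ?L y) \<partial>?N)"
        by (rule Bochner_Integration.integral_cong)
           (auto simp: dmass_def channel_mass_diff_def algebra_simps)
      also have "\<dots> = (\<integral>y. ?p y * ?x * ?L (inc_entry i y) \<partial>?N) - (\<integral>y. ?x * (?p y * ?L y) \<partial>?N)"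
        unfolding Bochner_Integration.integral_diff[OF 4 1] integral_inc_entry by simp
      also have "\<dots> = (\<integral>y. ?p y * ?x * (?L (inc_entry i y) - ?L y) \<partial>?N)"
        unfolding Bochner_Integration.integral_diff[OF 3 1, symmetric]
        by (rule Bochner_Integration.integral_cong) (auto simp: algebra_simps)
      finally show "(\<integral>y. dmass i j (fst (\<omega>, y)) (snd (\<omega>, y)) * info_density (fst (\<omega>, y)) (snd (\<omega>, y)) \<partial>?N) =
        (\<integral>y. mass (fst (\<omega>, y)) (snd (\<omega>, y)) * X (fst (\<omega>, y)) $ j *
          (info_density (fst (\<omega>, y)) (inc_entry i (snd (\<omega>, y))) - info_density (fst (\<omega>, y)) (snd (\<omega>, y))) \<partial>?N)"
        by simp
    qed
  qed
qed

text \<open>The factor y_i + 1 cancels between the recursions for p and q. The factor x_j stays in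
  the statement because z_i may be 0; then x_j = 0 by \<open>AE_input_0\<close> and both sides
  vanish.\<close>

lemma AE_info_density_diff:
  "AE \<omega> in M. \<forall>y. mass \<omega> y * X \<omega> $ j * (info_density \<omega> (inc_entry i y) - info_density \<omega> y) =
     mass \<omega> y * (X \<omega> $ j *
       (ln (channel_rate \<Phi> lam (X \<omega>) i) - ln (channel_rate \<Phi> lam (post_mean y) i)))"
  using AE_input_0[of i j] AE_outm_pos AE_mass_nonneg AE_rate_nonneg
proof eventually_elim
  fix \<omega>
  assume *: "channel_rate \<Phi> lam (X \<omega>) i = 0 \<longrightarrow> X \<omega> $ j = 0"
    and q: "\<forall>y. mass \<omega> y \<noteq> 0 \<longrightarrow> 0 < outm y" and p: "\<forall>y. 0 \<le> mass \<omega> y"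
    and r: "\<forall>i. 0 \<le> channel_rate \<Phi> lam (X \<omega>) i"
  show "\<forall>y. mass \<omega> y * X \<omega> $ j * (info_density \<omega> (inc_entry i y) - info_density \<omega> y) =
     mass \<omega> y * (X \<omega> $ j *
       (ln (channel_rate \<Phi> lam (X \<omega>) i) - ln (channel_rate \<Phi> lam (post_mean y) i)))"
  proof
    fix y
    define z where "z = channel_rate \<Phi> lam (X \<omega>) i"
    define w where "w = channel_rate \<Phi> lam (post_mean y) i"
    define n where "n = real (Suc (y $ i))"
    have n: "0 < n" by (simp add: n_def)
    show "mass \<omega> y * X \<omega> $ j * (info_density \<omega> (inc_entry i y) - info_density \<omega> y) =
     mass \<omega> y * (X \<omega> $ j *
       (ln (channel_rate \<Phi> lam (X \<omega>) i) - ln (channel_rate \<Phi> lam (post_mean y) i)))"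
    proof (cases "mass \<omega> y = 0 \<or> X \<omega> $ j = 0")
      case False
      then have m: "0 < mass \<omega> y" "0 < outm y" and z: "0 < z"
        using p q r * by (auto simp: less_le z_def simp del: vector_add_component)
      have w: "0 < w" using m post_rate_pos[of y i] by (simp add: w_def)
      have m': "mass \<omega> (inc_entry i y) = z * mass \<omega> y / n"
        using poisson_channel_mass_inc_entry[of y i \<Phi> lam "X \<omega>"] n
        by (simp add: z_def n_def field_simps del: of_nat_Suc vector_add_component)
      have o': "outm (inc_entry i y) = outm y * w / n"
        using outm_inc_entry[of y i] n
        by (simp add: w_def n_def field_simps del: of_nat_Suc vector_add_component)
      have "info_density \<omega> (inc_entry i y) - info_density \<omega> y = ln z - ln w"
        unfolding info_density_def m' o' using n m z w by (simp add: ln_div ln_mult)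
      then show ?thesis by (simp add: z_def w_def)
    qed auto
  qed
qed

end

subsection \<open>The generalized Bregman divergence\<close>

lemma has_derivative_vec_componentwise:
  fixes f :: "'a::real_normed_vector \<Rightarrow> 'b::euclidean_space^'k"
  assumes "\<And>i. ((\<lambda>x. f x $ i) has_derivative (\<lambda>h. f' h $ i)) (at a within S)"
  shows "(f has_derivative f') (at a within S)"
  unfolding has_derivative_componentwise_within[of f]
proof
  fix b :: "'b^'k" assume "b \<in> Basis"
  then obtain i e where "b = axis i e" by (auto simp: Basis_vec_def)
  then show "((\<lambda>x. f x \<bullet> b) has_derivative (\<lambda>x. f' x \<bullet> b)) (at a within S)"
    using has_derivative_inner_left[OF assms] by (simp add: inner_axis)
qed

text \<open>F is differentiated at the base point \<open>a\<close>, which therefore has to lie in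
  the open domain. The last two terms are minus a_j times the derivative of ln z_i at
  \<open>a\<close>, applied to x - a.\<close>

lemma gen_bregman_poisson_bregman_fun:
  fixes \<Phi> :: "real^'n^'m"
  assumes a: "a \<in> poisson_bregman_dom \<Phi> lam"
  shows "gen_bregman (poisson_bregman_fun \<Phi> lam) x a $ i $ j =
     x $ j * (ln (channel_rate \<Phi> lam x i) - ln (channel_rate \<Phi> lam a i))
     - a $ j / channel_rate \<Phi> lam a i * channel_rate \<Phi> lam x i + a $ j"
proof -
  define D :: "real^'n \<Rightarrow> real^'n^'m" where
    "D = (\<lambda>h. \<chi> i j. h $ j * ln (channel_rate \<Phi> lam a i)
       + a $ j * ((\<Phi> *v h) $ i / channel_rate \<Phi> lam a i) - h $ j)"
  have lin: "((\<lambda>x. x $ k) has_derivative (\<lambda>h. h $ k)) (at a)" for k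
    by (rule bounded_linear_imp_has_derivative) (rule bounded_linear_vec_nth)
  have "(poisson_bregman_fun \<Phi> lam has_derivative D) (at a)"
  proof (intro has_derivative_vec_componentwise)
    fix i j
    have pos: "0 < channel_rate \<Phi> lam a i"
      using a by (simp add: poisson_bregman_dom_def)
    have "bounded_linear (\<lambda>x. (\<Phi> *v x) $ i)"
      by (rule bounded_linear_compose[OF bounded_linear_vec_nth matrix_vector_mul_bounded_linear])
    from has_derivative_add[OF bounded_linear_imp_has_derivative[OF this] has_derivative_const[of "lam $ i"]]
    have rate: "((\<lambda>x. channel_rate \<Phi> lam x i) has_derivative (\<lambda>h. (\<Phi> *v h) $ i)) (at a)"
      by simp
    show "((\<lambda>x. poisson_bregman_fun \<Phi> lam x $ i $ j) has_derivative (\<lambda>h. D h $ i $ j)) (at a)"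
      unfolding poisson_bregman_fun_def D_def vec_lambda_beta
      by (rule derivative_eq_intros lin rate pos refl)+ (auto simp: fun_eq_iff field_simps)
  qed
  from frechet_derivative_at[OF this]
  have D: "frechet_derivative (poisson_bregman_fun \<Phi> lam) (at a) = D" by simp
  have lin: "(\<Phi> *v (x - a)) $ i = channel_rate \<Phi> lam x i - channel_rate \<Phi> lam a i"
    by (simp add: matrix_vector_mult_diff_distrib)
  have "gen_bregman (poisson_bregman_fun \<Phi> lam) x a $ i $ j =
      poisson_bregman_fun \<Phi> lam x $ i $ j - poisson_bregman_fun \<Phi> lam a $ i $ j - D (x - a) $ i $ j"
    by (simp add: gen_bregman_def D)
  moreover have "0 < channel_rate \<Phi> lam a i"
    using a by (simp add: poisson_bregman_dom_def)
  ultimately show ?thesis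
    unfolding D_def poisson_bregman_fun_def vec_lambda_beta lin vector_minus_component
    by (simp add: field_simps del: vector_add_component)
qed

text \<open>Integrability runs backwards: \<open>div\<close>, \<open>integrable_post_ratio\<close>
  and \<open>integrable_post_mean\<close> give it for \<open>h\<close>, hence for \<open>?H\<close>,
  as summation by parts requires. The ratio and the posterior mean then cancel in
  expectation.\<close>

lemma (in regular_poisson_channel) has_real_derivative_info_bregman:
  assumes div: "integrable M
    (\<lambda>\<omega>. gen_bregman (poisson_bregman_fun \<Phi> lam) (X \<omega>) (cond_mean M X Y \<omega>))"
  shows "((\<lambda>s. \<integral>z. info_at i j s (fst z) (snd z) \<partial>Q) has_real_derivative
      (\<integral>\<omega>. gen_bregman (poisson_bregman_fun \<Phi> lam) (X \<omega>) (cond_mean M X Y \<omega>) \<partial>M) $ i $ j)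
    (at (\<Phi> $ i $ j) within {0..})"
proof -
  let ?B = "\<lambda>\<omega>. gen_bregman (poisson_bregman_fun \<Phi> lam) (X \<omega>) (cond_mean M X Y \<omega>)"
  let ?c = "\<lambda>y. post_mean y $ j / channel_rate \<Phi> lam (post_mean y) i"
  let ?r = "\<lambda>\<omega>. ?c (Y \<omega>) * channel_rate \<Phi> lam (X \<omega>) i"
  let ?a = "\<lambda>\<omega>. post_mean (Y \<omega>) $ j"
  define h :: "(real^'n) \<times> (nat^'m) \<Rightarrow> real" where
    "h = (\<lambda>z. fst z $ j * (ln (channel_rate \<Phi> lam (fst z) i) - ln (channel_rate \<Phi> lam (post_mean (snd z)) i)))"
  have [measurable]: "h \<in> borel_measurable (borel \<Otimes>\<^sub>M count_space UNIV)"
    unfolding h_def channel_rate_eq by measurable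
  have entry: "bounded_linear (\<lambda>A :: real^'n^'m. A $ i $ j)"
    by (rule bounded_linear_compose[OF bounded_linear_vec_nth bounded_linear_vec_nth])
  have BI: "integrable M (\<lambda>\<omega>. ?B \<omega> $ i $ j)"
    by (rule integrable_bounded_linear[OF entry div])
  have ae: "AE \<omega> in M. h (X \<omega>, Y \<omega>) = ?B \<omega> $ i $ j + ?r \<omega> - ?a \<omega>"
    using dom AE_cond_mean
    by eventually_elim (simp add: gen_bregman_poisson_bregman_fun h_def del: vector_add_component)
  have I: "integrable M (\<lambda>\<omega>. ?B \<omega> $ i $ j + ?r \<omega> - ?a \<omega>)"
    by (intro Bochner_Integration.integrable_diff Bochner_Integration.integrable_add BI
        integrable_post_ratio integrable_post_mean)
  have hI: "integrable M (\<lambda>\<omega>. h (X \<omega>, Y \<omega>))"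
    by (rule integrable_cong_AE_imp[OF I]) (use ae in \<open>auto elim: AE_mp\<close>)
  let ?H = "\<lambda>z. mass (fst z) (snd z) * X (fst z) $ j *
      (info_density (fst z) (inc_entry i (snd z)) - info_density (fst z) (snd z))"
  have hQ: "integrable Q (\<lambda>z. mass (fst z) (snd z) * h (X (fst z), snd z))"
    using hI by (simp add: integrable_joint)
  have [measurable]: "?H \<in> borel_measurable Q"
    by (rule measurable_pair_count_space[where f = "\<lambda>\<omega> y. mass \<omega> y * X \<omega> $ j *
          (info_density \<omega> (inc_entry i y) - info_density \<omega> y)"]) measurable
  have Hae: "AE z in Q. ?H z = mass (fst z) (snd z) * h (X (fst z), snd z)"
    using AE_pair_fst[OF sigma_finite_count_space AE_info_density_diff[where i = i and j = j]]
    by eventually_elim (simp add: h_def del: vector_add_component)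
  have HI: "integrable Q ?H"
    by (rule integrable_cong_AE_imp[OF hQ]) (use Hae in \<open>auto elim: AE_mp\<close>)
  have "(\<integral>z. dmass i j (fst z) (snd z) * info_density (fst z) (snd z) \<partial>Q) = (\<integral>z. ?H z \<partial>Q)"
    by (rule integral_dmass_info[OF HI])
  also have "\<dots> = (\<integral>z. mass (fst z) (snd z) * h (X (fst z), snd z) \<partial>Q)"
    by (rule integral_cong_AE) (use Hae hQ in auto)
  also have "\<dots> = (\<integral>\<omega>. h (X \<omega>, Y \<omega>) \<partial>M)"
    by (simp add: integral_joint)
  also have "\<dots> = (\<integral>\<omega>. ?B \<omega> $ i $ j + ?r \<omega> - ?a \<omega> \<partial>M)"
    by (rule integral_cong_AE) (use ae hI I in auto)
  also have "\<dots> = (\<integral>\<omega>. ?B \<omega> $ i $ j \<partial>M) + (\<integral>\<omega>. ?r \<omega> \<partial>M) - (\<integral>\<omega>. ?a \<omega> \<partial>M)"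
    by (simp only: Bochner_Integration.integral_diff Bochner_Integration.integral_add
        Bochner_Integration.integrable_add BI integrable_post_ratio integrable_post_mean)
  also have "\<dots> = (\<integral>\<omega>. ?B \<omega> $ i $ j \<partial>M)"
    by (simp only: integral_post_ratio)
  also have "\<dots> = (\<integral>\<omega>. ?B \<omega> \<partial>M) $ i $ j"
    by (rule integral_bounded_linear[OF entry div])
  finally show ?thesis
    using has_real_derivative_info[of i j] by simp
qed

theorem theorem5:
  fixes M :: "'a measure"
    and X :: "'a \<Rightarrow> real^'n"
    and Y :: "real^'n^'m \<Rightarrow> 'a \<Rightarrow> nat^'m"
    and \<Phi> :: "real^'n^'m" and lam :: "real^'m"
  assumes "prob_space M"
    and "X \<in> borel_measurable M"
    and "AE \<omega> in M. \<forall>j. 0 \<le> X \<omega> $ j"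
    and "\<forall>i j. 0 \<le> \<Phi> $ i $ j"
    and "\<forall>i. 0 \<le> lam $ i"
    and channel: "\<And>\<Psi>. \<forall>i j. 0 \<le> \<Psi> $ i $ j \<Longrightarrow> poisson_channel_output M \<Psi> lam X (Y \<Psi>)"
    and regular: "interchange_regular M X \<Phi> lam"
    and mean: "integrable M X"
    and dom: "AE \<omega> in M. cond_mean M X (Y \<Phi>) \<omega> \<in> poisson_bregman_dom \<Phi> lam"
    and div: "integrable M
      (\<lambda>\<omega>. gen_bregman (poisson_bregman_fun \<Phi> lam) (X \<omega>) (cond_mean M X (Y \<Phi>) \<omega>))"
  shows "has_matrix_gradient (\<lambda>\<Psi>. mutual_info M X (Y \<Psi>))
    (\<integral>\<omega>. gen_bregman (poisson_bregman_fun \<Phi> lam) (X \<omega>) (cond_mean M X (Y \<Phi>) \<omega>) \<partial>M) \<Phi>"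
  unfolding has_matrix_gradient_def
proof (intro allI)
  fix i j
  have ch: "poisson_channel M X (Y \<Psi>) \<Psi> lam" if "\<forall>i j. 0 \<le> \<Psi> $ i $ j" for \<Psi>
    using assms(1-3,5) channel[OF that] that
    by (simp add: poisson_channel_def poisson_channel_axioms_def)
  interpret regular_poisson_channel M X "Y \<Phi>" \<Phi> lam
    using ch[OF assms(4)] mean dom regular
    by (simp add: regular_poisson_channel_def regular_poisson_channel_axioms_def
        integrable_poisson_channel_def integrable_poisson_channel_axioms_def)
  \<comment> \<open>\<open>Y\<close> at a perturbed matrix enters only through its joint law with X,
    which the channel determines for nonnegative s.\<close>
  have eq: "(\<integral>z. info_at i j s (fst z) (snd z) \<partial>Q) = mutual_info M X (Y (upd_entry \<Phi> i j s))"
    if "s \<in> {0..}" for s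
    unfolding info_at_def
    using poisson_channel.mutual_info_eq[OF ch[OF upd_entry_nonneg[OF assms(4), of s i j]]] that
    by simp
  show "((\<lambda>s. mutual_info M X (Y (upd_entry \<Phi> i j s))) has_real_derivative
      (\<integral>\<omega>. gen_bregman (poisson_bregman_fun \<Phi> lam) (X \<omega>) (cond_mean M X (Y \<Phi>) \<omega>) \<partial>M) $ i $ j)
    (at (\<Phi> $ i $ j) within {0..})"
    \<comment> \<open>The radius 1 is arbitrary, since the two functions agree on the whole
      half-line.\<close>
    by (rule has_field_derivative_transform_within[OF has_real_derivative_info_bregman[OF div] zero_less_one])
       (use assms(4) eq in auto)
qed

end
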